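(* Let $P,Q$ be two probability measures on a measurable space $(\Omega,\mathcal F)$, let $(E,\mathcal E)$ be a measurable space and let $\varphi:\Omega\to E$ be a measurable function. Let $f\in\mathbb F$ and set $\lambda=(P+Q)/2$. Then $$D_f(\varphi_\sharp P\,\Vert\,\varphi_\sharp Q)\le D_f(P\Vert Q),$$ and, $\lambda$-a.s., $$\frac{d\varphi_\sharp P}{d\varphi_\sharp Q}\circ\varphi=\frac{\mathbb E_Q\left[\frac{dP}{dQ}\,\big|\,\varphi\right]}{P\left(\frac{dP}{dQ}<+\infty\,\big|\,\varphi\right)}\in(0,+\infty)\quad\text{on the event}\quad\left\{\mathbb E_\lambda\left[\frac{dP}{d\lambda}\,\frac{dQ}{d\lambda}\,\big|\,\varphi\right]>0\right\}.$$ Furthermore, if $f$ is strictly convex on $(0,+\infty)$ and $D_f(P\Vert Q)$ is finite, then $D_f(\varphi_\sharp P\,\Vert\,\varphi_\sharp Q)=D_f(P\Vert Q)$ if and only if there exists a nonnegative ($[0,+\infty]$-valued) measurable function $h$ defined on $E$ such that $$\frac{dP}{dQ}=h\circ\varphi\quad\lambda\text{-a.s.}$$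
   Context: Convexity. A proper convex function on $\mathbb R$ is a convex function with values in $(-\infty,+\infty]$ that is finite at some point; $\mathrm{dom}(f)=f^{-1}(\mathbb R)$. It is strictly convex at $z\in\mathbb R$ if for all $x,y\in\mathbb R\setminus\{z\}$ and $\alpha\in(0,1)$ with $z=\alpha x+(1-\alpha)y$ one has $f(z)<\alpha f(x)+(1-\alpha)f(y)$ (in particular $z\in\mathrm{dom}(f)$); strictly convex on a set means strictly convex at each of its points. $\mathbb F$ is the set of proper convex functions $f$ on $\mathbb R$ with $\mathrm{dom}(f)\subset\mathbb R_+=[0,\infty)$, right continuous at $0$ (i.e. $f(0)=\lim_{t\to0+}f(t)\in(-\infty,+\infty]$), $f(1)=0$, and $1$ in the interior of $\mathrm{dom}(f)$. For $f\in\mathbb F$, $f^*(0):=\lim_{t\to+\infty}f(t)/t\in(-\infty,+\infty]$. Ratio of densities. For $\sigma$-finite measures (in particular probability measures) $P,Q$ on $(\Omega,\mathcal F)$, not assumed absolutely continuous with respect to each other, let $\lambda$ be a $\sigma$-finite measure dominating $P+Q$ (e.g. $P+Q$), with $P=p\lambda$, $Q=q\lambda$; then $\frac{dP}{dQ}:=p/q\in[0,+\infty]$, with the convention $0/0=0$ (and $p/q=+\infty$ where $p>0=q$). It is defined $(P+Q)$-a.e. and does not depend on $\lambda$; it is the usual Radon–Nikodym derivative when $P\ll Q$. $f$-divergence. For probability measures $P,Q$ on the same measurable space and $f\in\mathbb F$, $$D_f(P\Vert Q)=\int f\left(\frac{dP}{dQ}\right)dQ+f^*(0)\,P\left(\frac{dP}{dQ}=+\infty\right),$$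 where the last term is $0$ by convention if $P\ll Q$. It is well defined in $(-\infty,+\infty]$. $\varphi_\sharp P=P\circ\varphi^{-1}$ denotes the push-forward measure. For a probability measure $\mu$ on $\Omega$, $\mathbb E_\mu[\,\cdot\,|\,\varphi]$ is conditional expectation under $\mu$ given $\sigma(\varphi)$, and $P(A\,|\,\varphi)=\mathbb E_P[\mathbf 1_A\,|\,\varphi]$. *)

theory Defs
  imports "HOL-Probability.Probability"
begin

definition eff_dom :: "(real \<Rightarrow> ereal) \<Rightarrow> real set" where
  "eff_dom f = {x. \<bar>f x\<bar> \<noteq> \<infinity>}"

definition proper_convex :: "(real \<Rightarrow> ereal) \<Rightarrow> bool" where
  "proper_convex f \<longleftrightarrow>
     (\<forall>x. f x \<noteq> -\<infinity>) \<and> eff_dom f \<noteq> {} \<and>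
     (\<forall>x y. \<forall>a\<in>{0<..<1}.
        f (a * x + (1 - a) * y) \<le> ereal a * f x + ereal (1 - a) * f y)"

definition strictly_convex_at :: "(real \<Rightarrow> ereal) \<Rightarrow> real \<Rightarrow> bool" where
  "strictly_convex_at f z \<longleftrightarrow>
     (\<forall>x\<in>UNIV - {z}. \<forall>y\<in>UNIV - {z}. \<forall>a\<in>{0<..<1}.
        z = a * x + (1 - a) * y \<longrightarrow> f z < ereal a * f x + ereal (1 - a) * f y)"

definition strictly_convex_on :: "(real \<Rightarrow> ereal) \<Rightarrow> real set \<Rightarrow> bool" where
  "strictly_convex_on f S \<longleftrightarrow> (\<forall>z\<in>S. strictly_convex_at f z)"

definition divergence_generators :: "(real \<Rightarrow> ereal) set" where
  "divergence_generators =
     {f. proper_convex f \<and> eff_dom f \<subseteq> {0..} \<and> (f \<longlongrightarrow> f 0) (at_right 0) \<and>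
         f 1 = 0 \<and> 1 \<in> interior (eff_dom f)}"

text \<open>The slope at infinity, written \<open>f\<^sup>*(0)\<close> in terms of the conjugate generator
  \<open>f\<^sup>*(t) = t f(1/t)\<close>.\<close>

definition slope_at_infinity :: "(real \<Rightarrow> ereal) \<Rightarrow> ereal" where
  "slope_at_infinity f = Lim at_top (\<lambda>t. f t / ereal t)"

definition sum_measure :: "'a measure \<Rightarrow> 'a measure \<Rightarrow> 'a measure" where
  "sum_measure P Q = measure_of (space P) (sets P) (\<lambda>A. emeasure P A + emeasure Q A)"

lemma sets_sum_measure [simp, measurable_cong]: "sets (sum_measure P Q) = sets P"
  by (simp add: sum_measure_def)

lemma space_sum_measure [simp]: "space (sum_measure P Q) = space P"
  by (simp add: sum_measure_def)

lemma emeasure_sum_measure: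
  assumes "sets Q = sets P" and "A \<in> sets P"
  shows "emeasure (sum_measure P Q) A = emeasure P A + emeasure Q A"
proof (rule emeasure_measure_of[OF sum_measure_def])
  show "countably_additive (sets (sum_measure P Q)) (\<lambda>A. emeasure P A + emeasure Q A)"
  proof (rule countably_additiveI)
    fix F :: "nat \<Rightarrow> 'a set"
    assume F: "range F \<subseteq> sets (sum_measure P Q)" "disjoint_family F"
    then have "(\<Sum>i. emeasure P (F i) + emeasure Q (F i))
        = (\<Sum>i. emeasure P (F i)) + (\<Sum>i. emeasure Q (F i))"
      by (intro suminf_add[symmetric]) auto
    also have "\<dots> = emeasure P (\<Union>i. F i) + emeasure Q (\<Union>i. F i)"
      using F assms(1) by (simp add: suminf_emeasure)
    finally show "(\<Sum>i. emeasure P (F i) + emeasure Q (F i))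
        = emeasure P (\<Union>i. F i) + emeasure Q (\<Union>i. F i)" .
  qed
qed (use assms sets.space_closed in \<open>auto simp: positive_def\<close>)

text \<open>The \<open>[0, \<infinity>]\<close>-valued ratio \<open>dP/dQ = p/q\<close>, computed with the dominating measure \<open>P + Q\<close>.
  Division on \<^typ>\<open>ennreal\<close> satisfies \<open>0 / 0 = 0\<close> and \<open>p / 0 = \<infinity>\<close> for \<open>p > 0\<close>.  As for
  \<^const>\<open>RN_deriv\<close>, a version is selected, so the values are meaningful only up to
  \<open>(P + Q)\<close>-null sets; the lemma below shows independence of the dominating measure.\<close>

definition density_ratio :: "'a measure \<Rightarrow> 'a measure \<Rightarrow> 'a \<Rightarrow> ennreal" where
  "density_ratio P Q x =
     RN_deriv (sum_measure P Q) P x / RN_deriv (sum_measure P Q) Q x"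

lemma density_ratio_eq:
  assumes L: "sigma_finite_measure L"
    and [measurable]: "p \<in> borel_measurable L" "q \<in> borel_measurable L"
    and P: "P = density L p" "sigma_finite_measure P"
    and Q: "Q = density L q" "sigma_finite_measure Q"
  shows "AE x in sum_measure P Q. density_ratio P Q x = p x / q x"
proof -
  interpret L: sigma_finite_measure L by fact
  define S where "S = sum_measure P Q"
  have sets: "sets P = sets L" "sets Q = sets L"
    by (simp_all add: P Q)
  have S: "S = density L (\<lambda>x. p x + q x)"
  proof (rule measure_eqI)
    fix A assume "A \<in> sets S"
    then have A: "A \<in> sets L" by (simp add: S_def sets)
    then show "emeasure S A = emeasure (density L (\<lambda>x. p x + q x)) A"
      using sets
      by (simp add: S_def emeasure_sum_measure P(1) Q(1) emeasure_density
          distrib_right nn_integral_add)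
  qed (simp add: S_def sets)
  have pfin: "AE x in L. p x \<noteq> \<infinity>" and qfin: "AE x in L. q x \<noteq> \<infinity>"
    using P Q L.sigma_finite_iff_density_finite[of p] L.sigma_finite_iff_density_finite[of q]
    by auto
  have "AE x in L. p x + q x \<noteq> \<infinity>"
    using pfin qfin by eventually_elim auto
  then interpret S: sigma_finite_measure S
    unfolding S by (subst L.sigma_finite_iff_density_finite) auto
  have emS: "emeasure S A = emeasure P A + emeasure Q A" if "A \<in> sets P" for A
    using that sets by (simp add: S_def emeasure_sum_measure)
  have acP: "absolutely_continuous S P" and acQ: "absolutely_continuous S Q"
    using emS by (auto simp: absolutely_continuous_def null_sets_def S_def sets)
  define a where "a = RN_deriv S P"
  define b where "b = RN_deriv S Q"
  have [measurable]: "a \<in> borel_measurable L" "b \<in> borel_measurable L"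
    using borel_measurable_RN_deriv[of S P] borel_measurable_RN_deriv[of S Q]
    by (simp_all add: a_def b_def S)
  have "density L (\<lambda>x. (p x + q x) * a x) = density L p"
    using S.density_RN_deriv[OF acP] sets
    by (subst density_density_eq[symmetric]) (simp_all flip: S P(1) a_def, simp add: S_def)
  then have ap: "AE x in L. (p x + q x) * a x = p x"
    by (subst (asm) L.density_unique_iff) auto
  have "density L (\<lambda>x. (p x + q x) * b x) = density L q"
    using S.density_RN_deriv[OF acQ] sets
    by (subst density_density_eq[symmetric]) (simp_all flip: S Q(1) b_def, simp add: S_def)
  then have bq: "AE x in L. (p x + q x) * b x = q x"
    by (subst (asm) L.density_unique_iff) auto
  have "AE x in L. 0 < p x + q x \<longrightarrow> a x / b x = p x / q x"
    using ap bq pfin qfin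
  proof eventually_elim
    case (elim x)
    show ?case
    proof
      assume "0 < p x + q x"
      then have "((p x + q x) * a x) / ((p x + q x) * b x) = a x / b x"
        using elim(3,4) divide_mult_eq[of "p x + q x" "a x" "b x"]
        by (metis ennreal_add_eq_top infinity_ennreal_def less_irrefl mult.commute)
      then show "a x / b x = p x / q x"
        using elim by simp
    qed
  qed
  then have "AE x in S. a x / b x = p x / q x"
    unfolding S by (subst AE_density) auto
  then show ?thesis
    unfolding S_def a_def b_def density_ratio_def .
qed

text \<open>The integral of an extended-real-valued function.  It is meaningful unless both parts
  are infinite, which does not happen for the integrand below: a generator is bounded below by
  an affine function.\<close>

definition ereal_integral :: "'a measure \<Rightarrow> ('a \<Rightarrow> ereal) \<Rightarrow> ereal" where
  "ereal_integral M g =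
     enn2ereal (\<integral>\<^sup>+ x. e2ennreal (g x) \<partial>M) - enn2ereal (\<integral>\<^sup>+ x. e2ennreal (- g x) \<partial>M)"

text \<open>The ratio is finite \<open>Q\<close>-almost everywhere, so the value that \<^const>\<open>enn2real\<close> assigns to
  \<open>\<infinity>\<close> is irrelevant.  The last term vanishes when \<open>P\<close> is absolutely continuous with respect
  to \<open>Q\<close>, because \<open>\<infinity> * 0 = 0\<close> on \<^typ>\<open>ereal\<close>.\<close>

definition f_divergence :: "(real \<Rightarrow> ereal) \<Rightarrow> 'a measure \<Rightarrow> 'a measure \<Rightarrow> ereal" where
  "f_divergence f P Q =
     ereal_integral Q (\<lambda>x. f (enn2real (density_ratio P Q x))) +
     slope_at_infinity f * ereal (measure P {x \<in> space P. density_ratio P Q x = \<infinity>})"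

text \<open>\<open>nn_cond_exp_given M \<phi> E g\<close> is \<open>\<bbbE>\<^sub>M[g | \<phi>]\<close> for nonnegative \<open>g\<close>, with \<open>\<phi>\<close> valued in \<open>E\<close>.\<close>

definition nn_cond_exp_given ::
    "'a measure \<Rightarrow> ('a \<Rightarrow> 'b) \<Rightarrow> 'b measure \<Rightarrow> ('a \<Rightarrow> ennreal) \<Rightarrow> 'a \<Rightarrow> ennreal" where
  "nn_cond_exp_given M \<phi> E g = nn_cond_exp M (vimage_algebra (space M) \<phi> E) g"

definition cond_prob_given ::
    "'a measure \<Rightarrow> ('a \<Rightarrow> 'b) \<Rightarrow> 'b measure \<Rightarrow> 'a set \<Rightarrow> 'a \<Rightarrow> ennreal" where
  "cond_prob_given M \<phi> E A = nn_cond_exp_given M \<phi> E (indicator A)"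

end

theory Submission
  imports Defs
begin

text \<open>Let \<open>S = P + Q\<close> and write \<open>P = x S\<close>, \<open>Q = (1 - x) S\<close> with \<open>0 \<le> x \<le> 1\<close>.  Then
\<open>dP/dQ = x / (1 - x)\<close>, and \<open>D\<^sub>f(P \<parallel> Q)\<close> is the \<open>S\<close>-integral of \<open>\<psi>(x)\<close>, where
\<open>\<psi>(x) = (1 - x) f(x / (1 - x))\<close> and \<open>\<psi>(1)\<close> is the slope of \<open>f\<close> at infinity
(\<open>f_divergence_eq_perspective_integral\<close>).  This perspective \<open>\<psi>\<close> is convex on \<open>[0, 1]\<close>, and the
term for the singular part of \<open>P\<close> has become an ordinary value of the integrand.  Pushing
forward along \<open>\<phi>\<close> replaces \<open>x\<close> by a function \<open>y\<close> on \<open>E\<close> such that \<open>y \<circ> \<phi>\<close> is the conditional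
expectation of \<open>x\<close> under \<open>S\<close>.  Hence the data processing inequality is the conditional Jensen
inequality for \<open>\<psi>\<close>.  If \<open>\<psi>\<close> is strictly convex and the integrals are finite, equality forces
\<open>x = y \<circ> \<phi>\<close> almost everywhere, that is, \<open>dP/dQ\<close> is a function of \<open>\<phi>\<close>.  Conversely, if
\<open>dP/dQ = h \<circ> \<phi>\<close>, then \<open>x\<close> is a function of \<open>\<phi>\<close>, so it equals its own conditional expectation.

Jensen's inequality is proved by integrating the supporting line of \<open>\<psi>\<close> at \<open>y \<circ> \<phi>\<close>
(\<open>jensen_defect\<close>).  Three difficulties have to be met.  The function \<open>\<psi>\<close> has no sign; subtracting
\<open>s (t - 1)\<close> from \<open>f\<close>, with \<open>s\<close> a subgradient at \<open>1\<close>, makes it nonnegative and does not change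
the divergence, since \<open>P\<close> and \<open>Q\<close> have the same mass.  The slopes of \<open>\<psi>\<close> may be unbounded, so
the linear terms are integrated only on sets where the slope is bounded, and these sets then
increase.  At an endpoint of its domain \<open>\<psi>\<close> may jump or have no supporting line; but where the
conditional mean of \<open>x\<close> reaches an endpoint of an interval that contains \<open>x\<close>, it agrees with \<open>x\<close>.

The formula for the ratio of the push-forwards is Bayes' rule.  If \<open>P = p L\<close>, \<open>Q = q L\<close> and
\<open>r = p / q\<close>, then \<open>r q\<close> and \<open>1\<^bsub>{r < \<infinity>}\<^esub> p\<close> are the same function \<open>p 1\<^bsub>{q > 0}\<^esub>\<close>.  By
\<open>nn_cond_exp_density\<close>, multiplying \<open>\<bbbE>\<^sub>Q[r | \<phi>]\<close> by the density \<open>q'\<close> of the push-forward of \<open>Q\<close>,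
or \<open>P(r < \<infinity> | \<phi>)\<close> by the density \<open>p'\<close> of that of \<open>P\<close>, gives the same
\<open>u = \<bbbE>\<^sub>L[p 1\<^bsub>{q > 0}\<^esub> | \<phi>]\<close>.  The event in the statement is contained in \<open>{u > 0}\<close> up to a null set, and there all
factors are positive and finite and the quotient is \<open>p' / q'\<close>.\<close>

section \<open>Convex generators and their perspectives\<close>

lemma
  assumes "f \<in> divergence_generators"
  shows generator_not_MInf: "f x \<noteq> -\<infinity>"
    and generator_convex: "a \<in> {0<..<1} \<Longrightarrow> f (a * x + (1 - a) * y) \<le> ereal a * f x + ereal (1 - a) * f y"
    and generator_neg: "x < 0 \<Longrightarrow> f x = \<infinity>"
    and generator_1: "f 1 = 0"
    and generator_interior: "1 \<in> interior (eff_dom f)"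
  using assms by (auto simp: divergence_generators_def proper_convex_def eff_dom_def)

lemma generator_dom_iff:
  assumes "f \<in> divergence_generators"
  shows "x \<in> eff_dom f \<longleftrightarrow> f x < \<infinity>"
  using generator_not_MInf[OF assms, of x] by (cases "f x") (auto simp: eff_dom_def)

text \<open>Convexity with the denominator cleared, the form in which slopes of chords are compared.\<close>

lemma generator_between:
  assumes f: "f \<in> divergence_generators" and "x < z" "z < y"
  shows "ereal (y - x) * f z \<le> ereal (y - z) * f x + ereal (z - x) * f y"
proof -
  define a where "a = (y - z) / (y - x)"
  have a: "a \<in> {0<..<1}" "1 - a = (z - x) / (y - x)"
    using assms by (auto simp: a_def field_simps)
  have "a * x + (1 - a) * y = z"
    unfolding a(2) unfolding a_def using assms by (simp add: divide_simps) (simp add: algebra_simps)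
  with generator_convex[OF f a(1), of x y]
  have *: "f z \<le> ereal a * f x + ereal (1 - a) * f y" by simp
  consider "f x = \<infinity>" | "f y = \<infinity>" | u v w where "f x = ereal u" "f y = ereal v" "f z = ereal w"
    using * generator_not_MInf[OF f, of x] generator_not_MInf[OF f, of y] generator_not_MInf[OF f, of z]
    by (cases "f x"; cases "f y"; cases "f z") auto
  then show ?thesis
  proof cases
    case 1
    then show ?thesis using assms generator_not_MInf[OF f, of y] by (cases "f y") auto
  next
    case 2
    then show ?thesis using assms generator_not_MInf[OF f, of x] by (cases "f x") auto
  next
    case 3
    from * have "w \<le> a * u + (1 - a) * v" using 3 by simp
    then have "(y - x) * w \<le> (y - x) * (a * u + (1 - a) * v)"
      using assms by (intro mult_left_mono) auto
    also have "\<dots> = (y - z) * u + (z - x) * v"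
      unfolding a(2) unfolding a_def using assms by (simp add: divide_simps)
    finally show ?thesis using 3 by simp
  qed
qed

lemma generator_dom_between:
  assumes f: "f \<in> divergence_generators" and "x < z" "z < y" "f x < \<infinity>" "f y < \<infinity>"
  shows "f z < \<infinity>"
  using generator_between[OF assms(1-3)] assms(2-5)
    generator_not_MInf[OF f, of x] generator_not_MInf[OF f, of y]
  by (cases "f x"; cases "f y"; cases "f z") auto

lemma generator_interior_between:
  assumes f: "f \<in> divergence_generators" and "x < z" "z < y" "f x < \<infinity>" "f y < \<infinity>"
  shows "z \<in> interior (eff_dom f)"
proof (rule interiorI)
  show "{x<..<y} \<subseteq> eff_dom f"
    using generator_dom_between[OF f] assms by (auto simp: generator_dom_iff)
qed (use assms in auto)

text \<open>The sublevel sets of a convex function are intervals.\<close>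

lemma borel_measurable_generator:
  assumes f: "f \<in> divergence_generators"
  shows "f \<in> borel_measurable borel"
proof (rule borel_measurableI_le)
  fix c
  have "is_interval {x. f x \<le> c}"
  proof (unfold is_interval_1, intro ballI allI impI)
    fix x y z assume x: "x \<in> {x. f x \<le> c}" and y: "y \<in> {x. f x \<le> c}" and z: "x \<le> z \<and> z \<le> y"
    show "z \<in> {x. f x \<le> c}"
    proof (cases "z = x \<or> z = y")
      case False
      with z have xy: "x < z" "z < y" by auto
      have bd: "(z - x) * b + (y - z) * a \<le> (y - x) * e" if "a \<le> e" "b \<le> e" for a b e
      proof -
        have "(z - x) * b + (y - z) * a \<le> (z - x) * e + (y - z) * e"
          using that xy by (intro add_mono mult_left_mono) auto
        then show ?thesis by (simp add: algebra_simps)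
      qed
      have "f z \<le> c"
        using generator_between[OF f xy] x y xy
          generator_not_MInf[OF f, of x] generator_not_MInf[OF f, of y]
        apply (cases "f x"; cases "f y"; cases "f z"; cases c; simp)
        subgoal for a b w e using bd[of a e b]
          by (smt (verit, ccfv_SIG) mult_left_le_imp_le)
        done
      then show ?thesis by simp
    qed (use x y in auto)
  qed
  then show "{x \<in> space borel. f x \<le> c} \<in> sets borel"
    using real_interval_borel_measurable by simp
qed

definition subgradient :: "(real \<Rightarrow> ereal) \<Rightarrow> real \<Rightarrow> real \<Rightarrow> bool" where
  "subgradient f t k \<longleftrightarrow> (\<forall>u. f t + ereal (k * (u - t)) \<le> f u)"

lemma subgradient_exists:
  assumes f: "f \<in> divergence_generators" and t: "t \<in> interior (eff_dom f)"
  obtains k where "subgradient f t k"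
proof -
  define g where "g = (\<lambda>x. real_of_ereal (f x))"
  have fg: "f x = ereal (g x)" if "x \<in> eff_dom f" for x
    using that by (auto simp: g_def eff_dom_def ereal_real)
  have cv: "convex (eff_dom f)"
  proof (rule is_interval_convex, unfold is_interval_1, intro ballI allI impI)
    fix x y z assume "x \<in> eff_dom f" "y \<in> eff_dom f" "x \<le> z \<and> z \<le> y"
    then show "z \<in> eff_dom f"
      using generator_dom_between[OF f, of x z y]
      by (cases "z = x \<or> z = y") (auto simp: generator_dom_iff[OF f])
  qed
  have "convex_on (eff_dom f) g"
  proof (rule convex_onI[OF _ cv])
    fix a x y :: real assume a: "0 < a" "a < 1" and xy: "x \<in> eff_dom f" "y \<in> eff_dom f"
    have "(1 - a) *\<^sub>R x + a *\<^sub>R y \<in> eff_dom f"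
      using cv a xy unfolding convex_alt by auto
    then show "g ((1 - a) *\<^sub>R x + a *\<^sub>R y) \<le> (1 - a) * g x + a * g y"
      using generator_convex[OF f, of "1 - a" x y] a xy by (simp add: fg)
  qed
  from convex_le_Inf_differential[OF this t]
  obtain k where k: "\<And>u. u \<in> eff_dom f \<Longrightarrow> g t + k * (u - t) \<le> g u" by blast
  have "t \<in> eff_dom f" using t interior_subset by blast
  then have "subgradient f t k"
    using k generator_dom_iff[OF f] by (auto simp: subgradient_def fg not_less)
      (metis fg k linorder_not_less ereal_less_eq(1,3) plus_ereal.simps(1))
  then show ?thesis by (rule that)
qed

text \<open>If the supporting line at \<open>t\<close> met the graph again at \<open>u\<close>, strict convexity would push the graph
below that line at the midpoint of \<open>t\<close> and \<open>u\<close>.  The midpoint is positive because \<open>f\<close> is infinite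
on the negative half-line.\<close>

lemma subgradient_strict:
  assumes f: "f \<in> divergence_generators" and sc: "strictly_convex_on f {0<..}"
    and t: "t \<in> eff_dom f" "0 < t" and k: "subgradient f t k" and "u \<noteq> t"
  shows "f t + ereal (k * (u - t)) < f u"
proof (rule ccontr)
  assume "\<not> f t + ereal (k * (u - t)) < f u"
  with k have eq: "f u = f t + ereal (k * (u - t))"
    by (auto simp: subgradient_def not_less intro: antisym)
  obtain c where c: "f t = ereal c" using t by (auto simp: eff_dom_def)
  have "0 \<le> u" using eq c generator_neg[OF f, of u] by (cases "u < 0") auto
  define w where "w = 1/2 * t + (1 - 1/2) * u"
  have "w > 0" "w \<noteq> t" "w \<noteq> u" using \<open>0 < t\<close> \<open>0 \<le> u\<close> \<open>u \<noteq> t\<close> by (auto simp: w_def)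
  then have "strictly_convex_at f w" using sc by (simp add: strictly_convex_on_def)
  then have "f w < ereal (1/2) * f t + ereal (1 - 1/2) * f u"
    unfolding strictly_convex_at_def
    using \<open>w \<noteq> t\<close> \<open>w \<noteq> u\<close> w_def
    by (elim ballE[of _ _ t] ballE[of _ _ u] ballE[of _ _ "1/2"] impE) (simp_all only:, simp_all)
  moreover have "f t + ereal (k * (w - t)) \<le> f w" using k by (simp add: subgradient_def)
  ultimately have "c + k * (w - t) < 1/2 * c + 1/2 * (c + k * (u - t))"
    unfolding eq c by (cases "f w") auto
  then show False by (simp add: w_def field_simps)
qed


lemma tendsto_at_top_SUP_mono:
  fixes F :: "real \<Rightarrow> 'a :: {complete_linorder, linorder_topology}"
  assumes "\<And>x y. b < x \<Longrightarrow> x \<le> y \<Longrightarrow> F x \<le> F y"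
  shows "(F \<longlongrightarrow> (SUP x\<in>{b<..}. F x)) at_top"
proof (rule order_tendstoI)
  fix y assume "y < (SUP x\<in>{b<..}. F x)"
  then obtain x0 where "b < x0" "y < F x0" by (auto simp: less_SUP_iff)
  show "eventually (\<lambda>x. y < F x) at_top"
    by (rule eventually_mono[OF eventually_ge_at_top[of x0]]) (use assms \<open>b < x0\<close> \<open>y < F x0\<close> in \<open>blast intro: less_le_trans\<close>)
next
  fix y assume y: "(SUP x\<in>{b<..}. F x) < y"
  show "eventually (\<lambda>x. F x < y) at_top"
    by (rule eventually_mono[OF eventually_gt_at_top[of b]])
      (use y in \<open>auto intro: le_less_trans[OF SUP_upper]\<close>)
qed

text \<open>Since \<open>f 1 = 0\<close>, the quotient \<open>f t / (t - 1)\<close> is the slope of a chord from \<open>1\<close>, which increases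
with \<open>t\<close>; it has the same limit as \<open>f t / t\<close>, so the limit that defines the slope at infinity exists.\<close>

lemma
  assumes f: "f \<in> divergence_generators"
  shows tendsto_slope_at_infinity: "((\<lambda>t. f t / ereal t) \<longlongrightarrow> slope_at_infinity f) at_top"
    and slope_at_infinity_upper: "1 < t \<Longrightarrow> f t / ereal (t - 1) \<le> slope_at_infinity f"
proof -
  define F where "F = (\<lambda>t. f t / ereal (t - 1))"
  define l where "l = (SUP t\<in>{1<..}. F t)"
  have "F x \<le> F y" if "1 < x" "x \<le> y" for x y
  proof (cases "x = y")
    case False
    with that have xy: "1 < x" "x < y" by auto
    show ?thesis
      using generator_between[OF f xy] xy generator_1[OF f]
        generator_not_MInf[OF f, of x] generator_not_MInf[OF f, of y]
      unfolding F_def by (cases "f x"; cases "f y") (auto simp: field_simps)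
  qed simp
  then have "(F \<longlongrightarrow> l) at_top"
    unfolding l_def by (rule tendsto_at_top_SUP_mono)
  moreover have "((\<lambda>t. ereal (1 - inverse t)) \<longlongrightarrow> ereal (1 - 0)) at_top"
    by (intro tendsto_intros tendsto_inverse_0_at_top filterlim_ident)
  ultimately have "((\<lambda>t. ereal (1 - inverse t) * F t) \<longlongrightarrow> ereal (1 - 0) * l) at_top"
    by (intro tendsto_mult_ereal) auto
  moreover have "eventually (\<lambda>t. ereal (1 - inverse t) * F t = f t / ereal t) at_top"
    using eventually_gt_at_top[of 1]
  proof eventually_elim
    case (elim t)
    then show ?case
      using generator_not_MInf[OF f, of t] unfolding F_def
      by (cases "f t") (auto simp: field_simps)
  qed
  ultimately have lim: "((\<lambda>t. f t / ereal t) \<longlongrightarrow> l) at_top"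
    by (simp add: tendsto_cong)
  then have l: "slope_at_infinity f = l"
    unfolding slope_at_infinity_def by (intro tendsto_Lim) auto
  show "((\<lambda>t. f t / ereal t) \<longlongrightarrow> slope_at_infinity f) at_top"
    using lim l by simp
  show "f t / ereal (t - 1) \<le> slope_at_infinity f" if "1 < t"
    unfolding l l_def using that by (auto simp: F_def intro: SUP_upper2)
qed

lemma generator_finite_if_slope_finite:
  assumes f: "f \<in> divergence_generators" and "slope_at_infinity f < \<infinity>" "1 < t"
  shows "f t < \<infinity>"
proof (rule ccontr)
  assume "\<not> ?thesis"
  then have "f t / ereal (t - 1) = \<infinity>" using \<open>1 < t\<close> by simp
  with slope_at_infinity_upper[OF f \<open>1 < t\<close>] assms show False by auto
qed

lemma subgradient_le_slope_at_infinity: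
  assumes f: "f \<in> divergence_generators" and k: "subgradient f t k" and t: "t \<in> eff_dom f"
  shows "ereal k \<le> slope_at_infinity f"
proof (rule tendsto_le[OF _ tendsto_slope_at_infinity[OF f]])
  define c where "c = real_of_ereal (f t)"
  have c: "f t = ereal c" using t by (auto simp: c_def eff_dom_def ereal_real)
  have "((\<lambda>u. (c - k * t) * inverse u + k) \<longlongrightarrow> (c - k * t) * 0 + k) at_top"
    by (intro tendsto_intros tendsto_inverse_0_at_top filterlim_ident)
  then show "((\<lambda>u. ereal ((c - k * t) * inverse u + k)) \<longlongrightarrow> ereal k) at_top"
    by simp
  show "eventually (\<lambda>u. ereal ((c - k * t) * inverse u + k) \<le> f u / ereal u) at_top"
    using eventually_gt_at_top[of 0]
  proof eventually_elim
    case (elim u)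
    have "f t + ereal (k * (u - t)) \<le> f u" using k by (simp add: subgradient_def)
    moreover have "(c - k * t) * inverse u + k = (c + k * (u - t)) / u"
      using elim by (simp add: field_simps)
    ultimately show ?case using elim unfolding c
      by (cases "f u") (auto simp: divide_right_mono)
  qed
qed simp

text \<open>When the slope at infinity is finite, \<open>f\<close> is finite to the right of \<open>t\<close>, and a subgradient at
\<open>t + 1\<close> separates the one at \<open>t\<close> from the slope at infinity.\<close>

lemma subgradient_less_slope_at_infinity:
  assumes f: "f \<in> divergence_generators" and sc: "strictly_convex_on f {0<..}"
    and t: "t \<in> eff_dom f" "0 < t" and k: "subgradient f t k"
  shows "ereal k < slope_at_infinity f"
proof (cases "slope_at_infinity f = \<infinity>")
  case False
  have fin: "f (t + 2) < \<infinity>"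
    using generator_finite_if_slope_finite[OF f] False t by auto
  have int: "t + 1 \<in> interior (eff_dom f)"
    by (rule generator_interior_between[OF f _ _ _ fin, of t]) (use t generator_dom_iff[OF f] in auto)
  then obtain k' where k': "subgradient f (t + 1) k'" using subgradient_exists[OF f] by blast
  have t1: "t + 1 \<in> eff_dom f" using int interior_subset by blast
  have "f t + ereal (k * (t + 1 - t)) < f (t + 1)"
    by (rule subgradient_strict[OF f sc t k]) simp
  moreover have "f (t + 1) + ereal (k' * (t - (t + 1))) \<le> f t"
    using k' by (simp only: subgradient_def)
  ultimately have "k < k'"
    using t t1 by (cases "f t"; cases "f (t + 1)") (auto simp: eff_dom_def)
  then show ?thesis
    using subgradient_le_slope_at_infinity[OF f k' t1] by (meson ereal_less(2) less_ereal.simps(1) less_le_trans)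
qed simp


text \<open>The perspective of \<open>t \<mapsto> f t - s (t - 1)\<close>, restricted to the segment of pairs \<open>(x, 1 - x)\<close>.
At \<open>x = 1\<close> the first summand is \<open>0\<close> whatever value \<open>f\<close> has at \<open>1 / 0 = 0\<close>, and the second one supplies
the limit value.  Conversion to \<^typ>\<open>ennreal\<close> loses nothing when \<open>s\<close> is a subgradient of \<open>f\<close> at \<open>1\<close>.\<close>

definition perspective :: "(real \<Rightarrow> ereal) \<Rightarrow> real \<Rightarrow> real \<Rightarrow> ennreal" where
  "perspective f s x =
     ennreal (1 - x) * e2ennreal (f (x / (1 - x)) - ereal (s * (x / (1 - x) - 1))) +
     e2ennreal (slope_at_infinity f - ereal s) * indicator {1} x"

lemma borel_measurable_perspective [measurable]:
  assumes "f \<in> divergence_generators"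
  shows "perspective f s \<in> borel_measurable borel"
proof -
  note [measurable] = borel_measurable_generator[OF assms]
  show ?thesis unfolding perspective_def[abs_def] by measurable
qed

text \<open>The linear part \<open>s (t - 1)\<close> becomes \<open>s (2 x - 1)\<close> under the perspective.  This gives one formula for
the values on \<open>[0, 1)\<close> and at \<open>1\<close>.\<close>

lemma perspective_finite_cases:
  assumes f: "f \<in> divergence_generators" and s: "subgradient f 1 s"
    and x: "0 \<le> x" "x \<le> 1" and fin: "perspective f s x < \<infinity>"
  obtains c where "enn2real (perspective f s x) = c - s * (2 * x - 1)"
    "x < 1 \<Longrightarrow> f (x / (1 - x)) = ereal (c / (1 - x))" "x = 1 \<Longrightarrow> slope_at_infinity f = ereal c"
proof (cases "x = 1")
  case True
  have le: "ereal s \<le> slope_at_infinity f"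
    using generator_interior[OF f] interior_subset
    by (intro subgradient_le_slope_at_infinity[OF f s]) auto
  then obtain c where c: "slope_at_infinity f = ereal c"
    using fin True by (cases "slope_at_infinity f") (auto simp: perspective_def)
  then show ?thesis using le True by (intro that[of c]) (auto simp: perspective_def)
next
  case False
  define u where "u = x / (1 - x)"
  have le: "ereal (s * (u - 1)) \<le> f u" using s generator_1[OF f] by (simp add: subgradient_def)
  then obtain d where d: "f u = ereal d"
    using fin False x by (cases "f u") (auto simp: perspective_def ennreal_mult_top simp flip: u_def)
  have "(1 - x) * (d - s * (u - 1)) = (1 - x) * d - s * (2 * x - 1)"
    using False by (simp add: u_def field_simps)
  moreover have "perspective f s x = ennreal ((1 - x) * (d - s * (u - 1)))"
    unfolding perspective_def u_def[symmetric] d using False le d x by (simp add: ennreal_mult'')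
  moreover have "0 \<le> (1 - x) * (d - s * (u - 1))"
    using le d x by (intro mult_nonneg_nonneg) auto
  ultimately have "enn2real (perspective f s x) = (1 - x) * d - s * (2 * x - 1)" by simp
  then show ?thesis using False d by (intro that[of "(1 - x) * d"]) (auto simp flip: u_def)
qed

text \<open>The perspective of the affine function \<open>c + \<kappa> (u - t)\<close> is affine in \<open>x\<close>, so a supporting line of \<open>f\<close> at
\<open>t = a / (1 - a)\<close> becomes one of the perspective at \<open>a\<close>.  At \<open>x = 1\<close> its value is \<open>\<kappa>\<close>, up to the
contribution of \<open>s\<close>, and the comparison is with the slope of \<open>f\<close> at infinity.\<close>

lemma perspective_supporting_line:
  assumes f: "f \<in> divergence_generators" and s: "subgradient f 1 s"
    and a: "0 < a" "a < 1" "a / (1 - a) \<in> interior (eff_dom f)"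
  obtains k where "perspective f s a < \<infinity>"
    "\<And>x. 0 \<le> x \<Longrightarrow> x \<le> 1 \<Longrightarrow> perspective f s x < \<infinity> \<Longrightarrow>
       enn2real (perspective f s a) + k * (x - a) \<le> enn2real (perspective f s x)"
    "\<And>x. strictly_convex_on f {0<..} \<Longrightarrow> 0 \<le> x \<Longrightarrow> x \<le> 1 \<Longrightarrow> x \<noteq> a \<Longrightarrow> perspective f s x < \<infinity> \<Longrightarrow>
       enn2real (perspective f s a) + k * (x - a) < enn2real (perspective f s x)"
proof -
  define t where "t = a / (1 - a)"
  have t: "t \<in> eff_dom f" using a interior_subset by (auto simp: t_def)
  have t0: "0 < t" using a by (simp add: t_def)
  have at: "t * (1 - a) = a" using a by (simp add: t_def)
  obtain c where c: "f t = ereal c" using t by (auto simp: eff_dom_def)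
  have fin: "perspective f s a < \<infinity>"
    unfolding perspective_def t_def[symmetric] c using a by (simp add: ennreal_mult_less_top)
  have val: "enn2real (perspective f s a) = (1 - a) * c - s * (2 * a - 1)"
    by (rule perspective_finite_cases[OF f s _ _ fin]) (use a c in \<open>auto simp flip: t_def simp: field_simps\<close>)
  obtain \<kappa> where \<kappa>: "subgradient f t \<kappa>"
    using subgradient_exists[OF f] a by (auto simp: t_def)
  have line: "(1 - a) * c + (\<kappa> * (1 + t) - c) * (x - a) = (1 - x) * c + \<kappa> * (x - t * (1 - x))" for x
  proof -
    have "(1 - x) * c + \<kappa> * (x - t * (1 - x)) - ((1 - a) * c + (\<kappa> * (1 + t) - c) * (x - a))
        = \<kappa> * (a - t * (1 - a))" by (simp add: algebra_simps)
    then show ?thesis using at by simp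
  qed
  define k where "k = \<kappa> * (1 + t) - c - 2 * s"
  have shift: "enn2real (perspective f s a) + k * (x - a)
      = (1 - x) * c + \<kappa> * (x - t * (1 - x)) - s * (2 * x - 1)" for x
    unfolding val line[of x, symmetric] k_def by (simp add: algebra_simps)
  have lt1: "(1 - x) * (c + \<kappa> * (x / (1 - x) - t)) = (1 - x) * c + \<kappa> * (x - t * (1 - x))"
    if "x < 1" for x
    using that by (simp add: field_simps)
  show ?thesis
  proof (rule that[OF fin, of k])
    fix x assume x: "0 \<le> x" "x \<le> 1" and fx: "perspective f s x < \<infinity>"
    obtain d where d: "enn2real (perspective f s x) = d - s * (2 * x - 1)"
      "x < 1 \<Longrightarrow> f (x / (1 - x)) = ereal (d / (1 - x))" "x = 1 \<Longrightarrow> slope_at_infinity f = ereal d"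
      using perspective_finite_cases[OF f s x fx] by blast
    have "(1 - x) * c + \<kappa> * (x - t * (1 - x)) \<le> d"
    proof (cases "x = 1")
      case True
      then show ?thesis using subgradient_le_slope_at_infinity[OF f \<kappa> t] d(3) by simp
    next
      case False
      with x have x1: "x < 1" by simp
      have "c + \<kappa> * (x / (1 - x) - t) \<le> d / (1 - x)"
        using \<kappa> c d(2)[OF x1] by (metis ereal_less_eq(3) plus_ereal.simps(1) subgradient_def)
      then show ?thesis using lt1[OF x1] x1 by (simp add: pos_le_divide_eq mult.commute)
    qed
    then show "enn2real (perspective f s a) + k * (x - a) \<le> enn2real (perspective f s x)"
      unfolding shift d(1) by simp
  next
    fix x assume sc: "strictly_convex_on f {0<..}" and x: "0 \<le> x" "x \<le> 1" "x \<noteq> a"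
      and fx: "perspective f s x < \<infinity>"
    obtain d where d: "enn2real (perspective f s x) = d - s * (2 * x - 1)"
      "x < 1 \<Longrightarrow> f (x / (1 - x)) = ereal (d / (1 - x))" "x = 1 \<Longrightarrow> slope_at_infinity f = ereal d"
      using perspective_finite_cases[OF f s x(1,2) fx] by blast
    have "(1 - x) * c + \<kappa> * (x - t * (1 - x)) < d"
    proof (cases "x = 1")
      case True
      then show ?thesis using subgradient_less_slope_at_infinity[OF f sc t t0 \<kappa>] d(3) by simp
    next
      case False
      with x have x1: "x < 1" by simp
      have "x / (1 - x) \<noteq> t" using x x1 a by (auto simp: t_def field_simps)
      from subgradient_strict[OF f sc t t0 \<kappa> this]
      have "c + \<kappa> * (x / (1 - x) - t) < d / (1 - x)"
        unfolding c d(2)[OF x1] by simp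
      then show ?thesis using lt1[OF x1] x1 by (simp add: pos_less_divide_eq mult.commute)
    qed
    then show "enn2real (perspective f s a) + k * (x - a) < enn2real (perspective f s x)"
      unfolding shift d(1) by simp
  qed
qed

lemma perspective_finite_imp_interior:
  assumes f: "f \<in> divergence_generators" and s: "subgradient f 1 s"
    and y: "0 \<le> y" "perspective f s y < \<infinity>" and z: "z \<le> 1" "perspective f s z < \<infinity>"
    and a: "y < a" "a < z"
  shows "a / (1 - a) \<in> interior (eff_dom f)"
proof -
  have fin: "f (x / (1 - x)) < \<infinity>" if x: "0 \<le> x" "x < 1" "perspective f s x < \<infinity>" for x
    by (rule perspective_finite_cases[OF f s x(1) _ x(3)]) (use x in auto)
  have mono: "x / (1 - x) < x' / (1 - x')" if "x < x'" "x' < 1" for x x' :: real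
    using that by (simp add: field_simps)
  show ?thesis
  proof (cases "z = 1")
    case True
    have "slope_at_infinity f < \<infinity>"
      by (rule perspective_finite_cases[OF f s _ _ z(2)]) (use True in auto)
    from generator_finite_if_slope_finite[OF f this, of "a / (1 - a) + 2"]
    moreover have "0 < a / (1 - a)" using a y True by simp
    ultimately have "f (a / (1 - a) + 2) < \<infinity>" by simp
    from generator_interior_between[OF f mono[of y a] _ fin[of y] this] a y True
    show ?thesis by simp
  next
    case False
    then show ?thesis
      using generator_interior_between[OF f mono[of y a] mono[of a z] fin[of y] fin[of z]] assms by auto
  qed
qed

text \<open>Here \<open>c\<close> and \<open>d\<close> are the endpoints of the interval where the perspective is finite.  It contains
\<open>1/2\<close>, which corresponds to \<open>t = 1\<close>.\<close>

lemma perspective_supporting_slopes: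
  assumes f: "f \<in> divergence_generators" and s: "subgradient f 1 s"
  obtains c d k where "0 \<le> c" "d \<le> 1"
    "\<And>x. 0 \<le> x \<Longrightarrow> x \<le> 1 \<Longrightarrow> perspective f s x < \<infinity> \<Longrightarrow> c \<le> x \<and> x \<le> d"
    "\<And>a. c < a \<Longrightarrow> a < d \<Longrightarrow> perspective f s a < \<infinity>"
    "\<And>a x. c < a \<Longrightarrow> a < d \<Longrightarrow> 0 \<le> x \<Longrightarrow> x \<le> 1 \<Longrightarrow> perspective f s x < \<infinity> \<Longrightarrow>
       enn2real (perspective f s a) + k a * (x - a) \<le> enn2real (perspective f s x)"
    "\<And>a x. strictly_convex_on f {0<..} \<Longrightarrow> c < a \<Longrightarrow> a < d \<Longrightarrow> 0 \<le> x \<Longrightarrow> x \<le> 1 \<Longrightarrow>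
       perspective f s x < \<infinity> \<Longrightarrow> x \<noteq> a \<Longrightarrow>
       enn2real (perspective f s a) + k a * (x - a) < enn2real (perspective f s x)"
proof -
  define K where "K = {x. 0 \<le> x \<and> x \<le> 1 \<and> perspective f s x < \<infinity>}"
  have "perspective f s (1/2) < \<infinity>"
    by (simp add: perspective_def generator_1[OF f] ennreal_mult_less_top zero_ereal_def del: ereal_eq_0)
  then have K: "1/2 \<in> K" by (simp add: K_def)
  have bdd: "bdd_below K" "bdd_above K"
    unfolding K_def by (auto intro: bdd_belowI[of _ 0] bdd_aboveI[of _ 1])
  have inside: "0 < a \<and> a < 1 \<and> a / (1 - a) \<in> interior (eff_dom f)" if "Inf K < a" "a < Sup K" for a
  proof -
    from that obtain y z where "y \<in> K" "y < a" "z \<in> K" "a < z"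
      using K bdd by (metis cInf_less_iff less_cSup_iff empty_iff)
    then show ?thesis using perspective_finite_imp_interior[OF f s, of y z a] by (auto simp: K_def)
  qed
  have "\<exists>k. perspective f s a < \<infinity> \<and>
      (\<forall>x. 0 \<le> x \<longrightarrow> x \<le> 1 \<longrightarrow> perspective f s x < \<infinity> \<longrightarrow>
         enn2real (perspective f s a) + k * (x - a) \<le> enn2real (perspective f s x)) \<and>
      (\<forall>x. strictly_convex_on f {0<..} \<longrightarrow> 0 \<le> x \<longrightarrow> x \<le> 1 \<longrightarrow> x \<noteq> a \<longrightarrow> perspective f s x < \<infinity> \<longrightarrow>
         enn2real (perspective f s a) + k * (x - a) < enn2real (perspective f s x))"
    if "Inf K < a" "a < Sup K" for a
    using inside[OF that] perspective_supporting_line[OF f s, of a] by metis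
  then obtain k where k: "\<And>a. Inf K < a \<Longrightarrow> a < Sup K \<Longrightarrow> perspective f s a < \<infinity> \<and>
      (\<forall>x. 0 \<le> x \<longrightarrow> x \<le> 1 \<longrightarrow> perspective f s x < \<infinity> \<longrightarrow>
         enn2real (perspective f s a) + k a * (x - a) \<le> enn2real (perspective f s x)) \<and>
      (\<forall>x. strictly_convex_on f {0<..} \<longrightarrow> 0 \<le> x \<longrightarrow> x \<le> 1 \<longrightarrow> x \<noteq> a \<longrightarrow> perspective f s x < \<infinity> \<longrightarrow>
         enn2real (perspective f s a) + k a * (x - a) < enn2real (perspective f s x))"
    by metis
  show ?thesis
  proof (rule that[of "Inf K" "Sup K" k])
    show "0 \<le> Inf K" "Sup K \<le> 1"
      using K by (auto simp: K_def intro!: cInf_greatest cSup_least)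
    show "Inf K \<le> x \<and> x \<le> Sup K" if "0 \<le> x" "x \<le> 1" "perspective f s x < \<infinity>" for x
      using that bdd by (auto simp: K_def intro!: cInf_lower cSup_upper)
  qed (use k in blast)+
qed

section \<open>Jensen's inequality under a push-forward, with its defect\<close>

text \<open>Any choice of subgradients is monotone, hence measurable: add the inequalities of the supporting
lines at two points, each evaluated at the other point.\<close>

lemma supporting_slope_measurable:
  fixes \<psi> k :: "real \<Rightarrow> real"
  assumes supp: "\<And>a x. c < a \<Longrightarrow> a < d \<Longrightarrow> c < x \<Longrightarrow> x < d \<Longrightarrow> \<psi> a + k a * (x - a) \<le> \<psi> x"
  shows "(\<lambda>a. if c < a \<and> a < d then k a else 0) \<in> borel_measurable borel"
proof -
  have "mono_on {c<..<d} k"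
  proof (rule mono_onI)
    fix a b assume ab: "a \<in> {c<..<d}" "b \<in> {c<..<d}" "a \<le> b"
    then have "\<psi> a + k a * (b - a) \<le> \<psi> b" "\<psi> b + k b * (a - b) \<le> \<psi> a"
      using supp by auto
    then have "(k b - k a) * (b - a) \<ge> 0" by (simp add: algebra_simps)
    then show "k a \<le> k b"
      using ab by (cases "a = b") (auto simp: zero_le_mult_iff)
  qed
  then have "k \<in> borel_measurable (restrict_space borel {c<..<d})"
    by (rule borel_measurable_mono_on_fnc)
  then have "(\<lambda>a. if a \<in> {c<..<d} then k a else 0) \<in> borel_measurable borel"
    by (subst (asm) measurable_restrict_space_iff) auto
  then show ?thesis by simp
qed

text \<open>The equation between measures says that \<open>y \<circ> \<phi>\<close> is the conditional expectation of \<open>X\<close> given \<open>\<phi>\<close>.\<close>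

locale pushforward_density = finite_measure M for M :: "'a measure" +
  fixes E :: "'b measure" and \<phi> :: "'a \<Rightarrow> 'b" and X :: "'a \<Rightarrow> real" and y :: "'b \<Rightarrow> real"
  assumes meas [measurable]: "\<phi> \<in> measurable M E" "X \<in> borel_measurable M" "y \<in> borel_measurable E"
    and X01: "\<And>\<omega>. 0 \<le> X \<omega>" "\<And>\<omega>. X \<omega> \<le> 1"
    and y01: "\<And>e. 0 \<le> y e" "\<And>e. y e \<le> 1"
    and dens: "distr (density M (\<lambda>\<omega>. ennreal (X \<omega>))) E \<phi>
      = density (distr M E \<phi>) (\<lambda>e. ennreal (y e))"
begin

lemma integral_density_eq:
  fixes g :: "'b \<Rightarrow> real"
  assumes [measurable]: "g \<in> borel_measurable E"
  shows "(\<integral>\<omega>. g (\<phi> \<omega>) * X \<omega> \<partial>M) = (\<integral>\<omega>. g (\<phi> \<omega>) * y (\<phi> \<omega>) \<partial>M)"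
proof -
  have "(\<integral>\<omega>. g (\<phi> \<omega>) * X \<omega> \<partial>M) = (\<integral>\<omega>. g (\<phi> \<omega>) \<partial>density M (\<lambda>\<omega>. ennreal (X \<omega>)))"
    using X01 by (subst integral_real_density) (auto simp: mult.commute)
  also have "\<dots> = (\<integral>e. g e \<partial>distr (density M (\<lambda>\<omega>. ennreal (X \<omega>))) E \<phi>)"
    by (subst integral_distr) auto
  also have "\<dots> = (\<integral>\<omega>. g (\<phi> \<omega>) * y (\<phi> \<omega>) \<partial>M)"
    unfolding dens using y01
    by (subst integral_real_density) (auto simp: mult.commute integral_distr)
  finally show ?thesis .
qed

lemma integrable_bounded_mult:
  fixes g :: "'b \<Rightarrow> real"
  assumes [measurable]: "g \<in> borel_measurable E" and "\<And>e. \<bar>g e\<bar> \<le> b"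
  shows "integrable M (\<lambda>\<omega>. g (\<phi> \<omega>) * X \<omega>)" "integrable M (\<lambda>\<omega>. g (\<phi> \<omega>) * y (\<phi> \<omega>))"
proof -
  have "\<bar>g e * x\<bar> \<le> b" if "0 \<le> x" "x \<le> 1" for e x
    using mult_mono[of "\<bar>g e\<bar>" b "\<bar>x\<bar>" 1] assms(2)[of e] that by (auto simp: abs_mult)
  then show "integrable M (\<lambda>\<omega>. g (\<phi> \<omega>) * X \<omega>)" "integrable M (\<lambda>\<omega>. g (\<phi> \<omega>) * y (\<phi> \<omega>))"
    using X01 y01 by (auto intro!: integrable_const_bound[of _ b])
qed

text \<open>A variable that stays on one side of its conditional mean equals it, because the difference has
integral \<open>0\<close>.  The factor \<open>\<sigma>\<close> selects the side.\<close>

lemma AE_eq_if_ordered: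
  assumes [measurable]: "Measurable.pred E C"
    and le: "AE \<omega> in M. C (\<phi> \<omega>) \<longrightarrow> \<sigma> * X \<omega> \<le> \<sigma> * y (\<phi> \<omega>)" and "\<sigma> \<noteq> 0"
  shows "AE \<omega> in M. C (\<phi> \<omega>) \<longrightarrow> X \<omega> = y (\<phi> \<omega>)"
proof -
  define g where "g = (\<lambda>e. if C e then \<sigma> else 0)"
  have [measurable]: "g \<in> borel_measurable E" unfolding g_def by measurable
  have bd: "\<And>e. \<bar>g e\<bar> \<le> \<bar>\<sigma>\<bar>" by (simp add: g_def)
  note int = integrable_bounded_mult[OF \<open>g \<in> borel_measurable E\<close> bd]
  have "(\<integral>\<omega>. g (\<phi> \<omega>) * y (\<phi> \<omega>) - g (\<phi> \<omega>) * X \<omega> \<partial>M) = 0"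
    using int integral_density_eq[of g] by simp
  moreover have "AE \<omega> in M. 0 \<le> g (\<phi> \<omega>) * y (\<phi> \<omega>) - g (\<phi> \<omega>) * X \<omega>"
    using le by eventually_elim (auto simp: g_def)
  ultimately have "AE \<omega> in M. g (\<phi> \<omega>) * y (\<phi> \<omega>) - g (\<phi> \<omega>) * X \<omega> = 0"
    using int by (subst (asm) integral_nonneg_eq_0_iff_AE) auto
  then show ?thesis by eventually_elim (use \<open>\<sigma> \<noteq> 0\<close> in \<open>auto simp: g_def\<close>)
qed

text \<open>Jensen's inequality in the form of an identity: the excess is the integral of \<open>G\<close>, the height of
\<open>\<psi>(X)\<close> above the supporting line at the conditional mean.  At an endpoint \<open>c\<close> or \<open>d\<close>, where \<open>\<psi>\<close>
may jump, \<open>X\<close> agrees with its conditional mean and contributes no defect.\<close>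

proposition jensen_defect:
  fixes \<psi> :: "real \<Rightarrow> ennreal"
  assumes [measurable]: "\<psi> \<in> borel_measurable borel"
    and fin: "(\<integral>\<^sup>+\<omega>. \<psi> (X \<omega>) \<partial>M) < \<infinity>"
    and range: "\<And>x. 0 \<le> x \<Longrightarrow> x \<le> 1 \<Longrightarrow> \<psi> x < \<infinity> \<Longrightarrow> c \<le> x \<and> x \<le> d"
    and fin_inside: "\<And>a. c < a \<Longrightarrow> a < d \<Longrightarrow> \<psi> a < \<infinity>" and cd: "0 \<le> c" "d \<le> 1"
    and supp: "\<And>a x. c < a \<Longrightarrow> a < d \<Longrightarrow> 0 \<le> x \<Longrightarrow> x \<le> 1 \<Longrightarrow> \<psi> x < \<infinity> \<Longrightarrow>
       enn2real (\<psi> a) + k a * (x - a) \<le> enn2real (\<psi> x)"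
  obtains G where "G \<in> borel_measurable M"
    "(\<integral>\<^sup>+\<omega>. \<psi> (X \<omega>) \<partial>M) = (\<integral>\<^sup>+\<omega>. \<psi> (y (\<phi> \<omega>)) \<partial>M) + (\<integral>\<^sup>+\<omega>. G \<omega> \<partial>M)"
    "AE \<omega> in M. \<psi> (X \<omega>) < \<infinity> \<and> (X \<omega> = y (\<phi> \<omega>) \<or> c < y (\<phi> \<omega>) \<and> y (\<phi> \<omega>) < d \<and>
       G \<omega> = ennreal (enn2real (\<psi> (X \<omega>)) - (enn2real (\<psi> (y (\<phi> \<omega>))) + k (y (\<phi> \<omega>)) * (X \<omega> - y (\<phi> \<omega>)))))"
proof -
  define I where "I = (\<lambda>a. c < a \<and> a < d)"
  define \<kappa> where "\<kappa> = (\<lambda>a. if I a then k a else 0)"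
  have [measurable]: "Measurable.pred borel I" unfolding I_def by measurable
  have [measurable]: "\<kappa> \<in> borel_measurable borel"
    unfolding \<kappa>_def I_def
    by (rule supporting_slope_measurable[of c d "\<lambda>x. enn2real (\<psi> x)"])
      (use supp fin_inside cd in auto)
  define G where "G = (\<lambda>\<omega>. if I (y (\<phi> \<omega>)) then
    ennreal (enn2real (\<psi> (X \<omega>)) - (enn2real (\<psi> (y (\<phi> \<omega>))) + \<kappa> (y (\<phi> \<omega>)) * (X \<omega> - y (\<phi> \<omega>)))) else 0)"
  have [measurable]: "G \<in> borel_measurable M" unfolding G_def by measurable
  define h where "h = (\<lambda>\<omega>. \<psi> (y (\<phi> \<omega>)) + G \<omega>)"
  have [measurable]: "h \<in> borel_measurable M" unfolding h_def by measurable
  have finAE: "AE \<omega> in M. \<psi> (X \<omega>) < \<infinity>"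
    using nn_integral_PInf_AE[of "\<lambda>\<omega>. \<psi> (X \<omega>)" M] fin by (auto simp: less_top)
  have XAE: "AE \<omega> in M. c \<le> X \<omega> \<and> X \<omega> \<le> d"
    using finAE by eventually_elim (use range X01 in auto)

  \<comment> \<open>At or beyond an endpoint the mean lies on one side of \<open>X\<close>.\<close>
  have "AE \<omega> in M. d \<le> y (\<phi> \<omega>) \<longrightarrow> X \<omega> = y (\<phi> \<omega>)"
    by (rule AE_eq_if_ordered[of _ 1], simp, use XAE in eventually_elim) auto
  moreover have "AE \<omega> in M. y (\<phi> \<omega>) \<le> c \<longrightarrow> X \<omega> = y (\<phi> \<omega>)"
    by (rule AE_eq_if_ordered[of _ "-1"], simp, use XAE in eventually_elim) auto
  ultimately have outside: "AE \<omega> in M. \<not> I (y (\<phi> \<omega>)) \<longrightarrow> X \<omega> = y (\<phi> \<omega>)"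
    by eventually_elim (auto simp: I_def not_less)

  \<comment> \<open>The two sides of the claim are the total masses of these measures on \<open>E\<close>, which are compared
     piece by piece.\<close>
  define \<mu> where "\<mu> = distr (density M h) E \<phi>"
  define \<nu> where "\<nu> = distr (density M (\<lambda>\<omega>. \<psi> (X \<omega>))) E \<phi>"
  have em: "emeasure \<mu> C = (\<integral>\<^sup>+\<omega>. h \<omega> * indicator C (\<phi> \<omega>) \<partial>M)"
    "emeasure \<nu> C = (\<integral>\<^sup>+\<omega>. \<psi> (X \<omega>) * indicator C (\<phi> \<omega>) \<partial>M)" if "C \<in> sets E" for C
    using that unfolding \<mu>_def \<nu>_def
    by (auto simp: emeasure_distr emeasure_density indicator_def intro!: nn_integral_cong)
  have sets[simp]: "sets \<mu> = sets E" "sets \<nu> = sets E" by (auto simp: \<mu>_def \<nu>_def)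
  define A where "A n = {e \<in> space E. I (y e) \<and> \<bar>\<kappa> (y e)\<bar> \<le> real n}" for n
  have [measurable]: "A n \<in> sets E" for n unfolding A_def by measurable

  have step: "emeasure \<mu> (A n) = emeasure \<nu> (A n)" for n
  proof -
    define g where "g = (\<lambda>e. indicator (A n) e * \<kappa> (y e))"
    have [measurable]: "g \<in> borel_measurable E" unfolding g_def by measurable
    have bd: "\<And>e. \<bar>g e\<bar> \<le> real n" by (auto simp: g_def A_def indicator_def)
    note int = integrable_bounded_mult[OF \<open>g \<in> borel_measurable E\<close> bd]
    have intA: "integrable M (\<lambda>\<omega>. real n * indicator (A n) (\<phi> \<omega>))"
      by (rule integrable_const_bound[of _ "real n"]) (auto simp: indicator_def)
    \<comment> \<open>The linear term vanishes on average; adding the constant \<open>n\<close> on \<open>A n\<close> makes it nonnegative, so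
       that it can be cancelled as a finite nonnegative integral.\<close>
    define w where "w = (\<lambda>\<omega>. real n * indicator (A n) (\<phi> \<omega>) + (g (\<phi> \<omega>) * X \<omega> - g (\<phi> \<omega>) * y (\<phi> \<omega>)))"
    have gle: "\<bar>g e * (x - x')\<bar> \<le> real n * indicator (A n) e"
      if "0 \<le> x" "x \<le> 1" "0 \<le> x'" "x' \<le> 1" for e x x'
    proof -
      have "\<bar>x - x'\<bar> \<le> 1" using that by auto
      then have "\<bar>g e\<bar> * \<bar>x - x'\<bar> \<le> real n * 1" by (intro mult_mono bd) auto
      then show ?thesis by (cases "e \<in> A n") (auto simp: abs_mult g_def)
    qed
    have w_nonneg: "0 \<le> w \<omega>" for \<omega>
      using gle[of "X \<omega>" "y (\<phi> \<omega>)" "\<phi> \<omega>"] X01 y01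
      by (auto simp: w_def abs_le_iff algebra_simps)
    have "integral\<^sup>L M w = (\<integral>\<omega>. real n * indicator (A n) (\<phi> \<omega>) \<partial>M)"
      unfolding w_def using int intA integral_density_eq[of g] by simp
    moreover have "integrable M w" unfolding w_def using int intA by auto
    ultimately have w_int: "(\<integral>\<^sup>+\<omega>. ennreal (w \<omega>) \<partial>M) = (\<integral>\<^sup>+\<omega>. ennreal (real n * indicator (A n) (\<phi> \<omega>)) \<partial>M)"
      using intA w_nonneg by (subst (1 2) nn_integral_eq_integral) auto
    have w_fin: "(\<integral>\<^sup>+\<omega>. ennreal (w \<omega>) \<partial>M) \<noteq> \<infinity>"
      using nn_integral_eq_integral[OF \<open>integrable M w\<close>] w_nonneg by auto
    have [measurable]: "w \<in> borel_measurable M" unfolding w_def by measurable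
    have "emeasure \<mu> (A n) + (\<integral>\<^sup>+\<omega>. ennreal (w \<omega>) \<partial>M)
        = (\<integral>\<^sup>+\<omega>. h \<omega> * indicator (A n) (\<phi> \<omega>) + ennreal (w \<omega>) \<partial>M)"
      by (subst nn_integral_add) (auto simp: em)
    also have "\<dots> = (\<integral>\<^sup>+\<omega>. \<psi> (X \<omega>) * indicator (A n) (\<phi> \<omega>) + ennreal (real n * indicator (A n) (\<phi> \<omega>)) \<partial>M)"
    proof (rule nn_integral_cong_AE)
      show "AE \<omega> in M. h \<omega> * indicator (A n) (\<phi> \<omega>) + ennreal (w \<omega>)
        = \<psi> (X \<omega>) * indicator (A n) (\<phi> \<omega>) + ennreal (real n * indicator (A n) (\<phi> \<omega>))"
        using finAE
      proof eventually_elim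
        case (elim \<omega>)
        show ?case
        proof (cases "\<phi> \<omega> \<in> A n")
          case True
          then have I: "I (y (\<phi> \<omega>))" by (simp add: A_def)
          define p where "p = enn2real (\<psi> (X \<omega>))"
          define q where "q = enn2real (\<psi> (y (\<phi> \<omega>)))"
          define r where "r = \<kappa> (y (\<phi> \<omega>)) * (X \<omega> - y (\<phi> \<omega>))"
          have nn: "0 \<le> q" by (simp add: q_def)
          have p: "\<psi> (X \<omega>) = ennreal p" using elim by (simp add: p_def)
          have q: "\<psi> (y (\<phi> \<omega>)) = ennreal q"
            using fin_inside I by (simp add: q_def I_def)
          have le: "q + r \<le> p"
            using supp[of "y (\<phi> \<omega>)" "X \<omega>"] I X01 elim by (auto simp: p_def q_def r_def I_def \<kappa>_def)
          have w: "w \<omega> = real n + r" using True by (simp add: w_def r_def g_def algebra_simps)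
          have "h \<omega> = ennreal q + ennreal (p - (q + r))"
            unfolding h_def G_def q using I by (simp add: p_def q_def r_def)
          also have "\<dots> = ennreal (p - r)" using le nn by (simp flip: ennreal_plus)
          finally have "h \<omega> = ennreal (p - r)" .
          then show ?thesis
            using True w_nonneg[of \<omega>] le nn unfolding p w
            by (simp flip: ennreal_plus) (simp add: p_def flip: ennreal_plus)
        qed (auto simp: w_def g_def)
      qed
    qed
    also have "\<dots> = emeasure \<nu> (A n) + (\<integral>\<^sup>+\<omega>. ennreal (w \<omega>) \<partial>M)"
      unfolding w_int by (subst nn_integral_add) (auto simp: em)
    finally show ?thesis using w_fin
      by (simp add: ennreal_add_left_cancel add.commute[of _ "\<integral>\<^sup>+\<omega>. ennreal (w \<omega>) \<partial>M"])
  qed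

  have "incseq A"
    by (auto simp: A_def incseq_def intro: order_trans)
  then have inside: "emeasure \<mu> (\<Union>n. A n) = emeasure \<nu> (\<Union>n. A n)"
    using step SUP_emeasure_incseq[of A \<mu>] SUP_emeasure_incseq[of A \<nu>]
    by (simp add: image_subset_iff)
  have UA: "(\<Union>n. A n) = {e \<in> space E. I (y e)}"
    using real_arch_simple by (auto simp: A_def)
  have [measurable]: "space E - (\<Union>n. A n) \<in> sets E" by measurable
  have "AE \<omega> in M. h \<omega> * indicator (space E - (\<Union>n. A n)) (\<phi> \<omega>)
      = \<psi> (X \<omega>) * indicator (space E - (\<Union>n. A n)) (\<phi> \<omega>)"
    unfolding UA using outside by eventually_elim (auto simp: indicator_def h_def G_def)
  then have "emeasure \<mu> (space E - (\<Union>n. A n)) = emeasure \<nu> (space E - (\<Union>n. A n))"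
    by (simp add: em nn_integral_cong_AE del: UN_simps)
  then have "emeasure \<mu> (space E) = emeasure \<nu> (space E)"
    using inside plus_emeasure[of "\<Union>n. A n" \<mu> "space E - (\<Union>n. A n)"]
      plus_emeasure[of "\<Union>n. A n" \<nu> "space E - (\<Union>n. A n)"] sets.sets_into_space[of "\<Union>n. A n" E]
    by (auto simp: Un_absorb1)
  then have "(\<integral>\<^sup>+\<omega>. h \<omega> \<partial>M) = (\<integral>\<^sup>+\<omega>. \<psi> (X \<omega>) \<partial>M)"
    by (simp add: em measurable_space[OF meas(1)] cong: nn_integral_cong)
  then have "(\<integral>\<^sup>+\<omega>. \<psi> (X \<omega>) \<partial>M) = (\<integral>\<^sup>+\<omega>. \<psi> (y (\<phi> \<omega>)) \<partial>M) + (\<integral>\<^sup>+\<omega>. G \<omega> \<partial>M)"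
    unfolding h_def by (simp add: nn_integral_add)
  moreover have "AE \<omega> in M. \<psi> (X \<omega>) < \<infinity> \<and> (X \<omega> = y (\<phi> \<omega>) \<or> c < y (\<phi> \<omega>) \<and> y (\<phi> \<omega>) < d \<and>
       G \<omega> = ennreal (enn2real (\<psi> (X \<omega>)) - (enn2real (\<psi> (y (\<phi> \<omega>))) + k (y (\<phi> \<omega>)) * (X \<omega> - y (\<phi> \<omega>)))))"
    using finAE outside by eventually_elim (auto simp: I_def G_def \<kappa>_def)
  ultimately show ?thesis using \<open>G \<in> borel_measurable M\<close> by (intro that[of G]) auto
qed

text \<open>Under equality the defect \<open>G\<close> has integral \<open>0\<close>, and strict supporting lines make \<open>G\<close> positive
wherever \<open>X\<close> differs from its conditional mean.\<close>

lemma jensen_strict: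
  fixes \<psi> :: "real \<Rightarrow> ennreal"
  assumes [measurable]: "\<psi> \<in> borel_measurable borel"
    and fin: "(\<integral>\<^sup>+\<omega>. \<psi> (X \<omega>) \<partial>M) < \<infinity>"
    and range: "\<And>x. 0 \<le> x \<Longrightarrow> x \<le> 1 \<Longrightarrow> \<psi> x < \<infinity> \<Longrightarrow> c \<le> x \<and> x \<le> d"
    and fin_inside: "\<And>a. c < a \<Longrightarrow> a < d \<Longrightarrow> \<psi> a < \<infinity>" and cd: "0 \<le> c" "d \<le> 1"
    and supp: "\<And>a x. c < a \<Longrightarrow> a < d \<Longrightarrow> 0 \<le> x \<Longrightarrow> x \<le> 1 \<Longrightarrow> \<psi> x < \<infinity> \<Longrightarrow> x \<noteq> a \<Longrightarrow>
       enn2real (\<psi> a) + k a * (x - a) < enn2real (\<psi> x)"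
    and eq: "(\<integral>\<^sup>+\<omega>. \<psi> (y (\<phi> \<omega>)) \<partial>M) = (\<integral>\<^sup>+\<omega>. \<psi> (X \<omega>) \<partial>M)"
  shows "AE \<omega> in M. X \<omega> = y (\<phi> \<omega>)"
proof (rule jensen_defect[OF assms(1-6), of k])
  show "enn2real (\<psi> a) + k a * (x - a) \<le> enn2real (\<psi> x)"
    if "c < a" "a < d" "0 \<le> x" "x \<le> 1" "\<psi> x < \<infinity>" for a x
    using supp[OF that] by (cases "x = a") auto
next
  fix G :: "'a \<Rightarrow> ennreal"
  assume [measurable]: "G \<in> borel_measurable M"
    and G: "(\<integral>\<^sup>+\<omega>. \<psi> (X \<omega>) \<partial>M) = (\<integral>\<^sup>+\<omega>. \<psi> (y (\<phi> \<omega>)) \<partial>M) + (\<integral>\<^sup>+\<omega>. G \<omega> \<partial>M)"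
    and AE: "AE \<omega> in M. \<psi> (X \<omega>) < \<infinity> \<and> (X \<omega> = y (\<phi> \<omega>) \<or> c < y (\<phi> \<omega>) \<and> y (\<phi> \<omega>) < d \<and>
       G \<omega> = ennreal (enn2real (\<psi> (X \<omega>)) - (enn2real (\<psi> (y (\<phi> \<omega>))) + k (y (\<phi> \<omega>)) * (X \<omega> - y (\<phi> \<omega>)))))"
  have "(\<integral>\<^sup>+\<omega>. \<psi> (X \<omega>) \<partial>M) + 0 = (\<integral>\<^sup>+\<omega>. \<psi> (X \<omega>) \<partial>M) + (\<integral>\<^sup>+\<omega>. G \<omega> \<partial>M)"
    using G eq by simp
  then have "(\<integral>\<^sup>+\<omega>. G \<omega> \<partial>M) = 0"
    using fin ennreal_add_left_cancel by (metis infinity_ennreal_def less_irrefl)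
  then have "AE \<omega> in M. G \<omega> = 0" by (simp add: nn_integral_0_iff_AE)
  with AE show ?thesis
  proof eventually_elim
    case (elim \<omega>)
    show ?case
    proof (rule ccontr)
      assume ne: "X \<omega> \<noteq> y (\<phi> \<omega>)"
      with elim supp[of "y (\<phi> \<omega>)" "X \<omega>"] X01[of \<omega>] show False by (auto simp: ennreal_eq_0_iff)
    qed
  qed
qed

end

section \<open>The divergence as the integral of a perspective\<close>

text \<open>Splitting off an integrable part \<open>v\<close>.  All rearrangements take place between nonnegative integrals:
the negative part of \<open>g\<close> is dominated by that of \<open>v\<close>, so every subtracted term is finite.\<close>

lemma ereal_integral_decompose:
  fixes u :: "'a \<Rightarrow> ennreal" and v :: "'a \<Rightarrow> real"
  assumes [measurable]: "u \<in> borel_measurable M" "g \<in> borel_measurable M" and v: "integrable M v"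
    and g: "AE x in M. g x = enn2ereal (u x) + ereal (v x)"
  shows "ereal_integral M g = enn2ereal (\<integral>\<^sup>+x. u x \<partial>M) + ereal (\<integral>x. v x \<partial>M)"
proof -
  have [measurable]: "v \<in> borel_measurable M" using v by auto
  let ?a = "\<integral>\<^sup>+x. e2ennreal (g x) \<partial>M" and ?b = "\<integral>\<^sup>+x. e2ennreal (- g x) \<partial>M"
  let ?p = "\<integral>\<^sup>+x. ennreal (v x) \<partial>M" and ?n = "\<integral>\<^sup>+x. ennreal (- v x) \<partial>M"
  let ?u = "\<integral>\<^sup>+x. u x \<partial>M"
  have fin: "?p \<noteq> \<infinity>" "?n \<noteq> \<infinity>"
    using v by (auto simp: real_integrable_def)
  have "?b \<le> ?n"
  proof (rule nn_integral_mono_AE)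
    show "AE x in M. e2ennreal (- g x) \<le> ennreal (- v x)"
      using g
    proof eventually_elim
      case (elim x)
      then show ?case
        by (cases "u x") (auto simp: e2ennreal_neg intro: ennreal_leI)
    qed
  qed
  then have b: "?b \<noteq> \<infinity>" using fin by (auto simp: top_unique)
  have "?a + ?n = (\<integral>\<^sup>+x. e2ennreal (g x) + ennreal (- v x) \<partial>M)"
    by (subst nn_integral_add) auto
  also have "\<dots> = (\<integral>\<^sup>+x. u x + ennreal (v x) + e2ennreal (- g x) \<partial>M)"
  proof (rule nn_integral_cong_AE)
    show "AE x in M. e2ennreal (g x) + ennreal (- v x) = u x + ennreal (v x) + e2ennreal (- g x)"
      using g
    proof eventually_elim
      case (elim x)
      show ?case
      proof (cases "u x")
        case (real r)
        then show ?thesis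
          unfolding elim
          by (cases "0 \<le> v x"; cases "0 \<le> r + v x")
            (auto simp: ennreal_neg simp flip: ennreal_plus)
      qed (simp add: elim)
    qed
  qed
  also have "\<dots> = ?u + ?p + ?b"
    by (subst nn_integral_add, simp_all)+
  finally have eq: "?a + ?n = ?u + ?p + ?b" .
  have I: "(\<integral>x. v x \<partial>M) = enn2real ?p - enn2real ?n"
    by (rule real_lebesgue_integral_def[OF v])
  from fin b obtain p n b where 0: "0 \<le> p" "0 \<le> n" "0 \<le> b" and
    pnb: "?p = ennreal p" "?n = ennreal n" "?b = ennreal b"
    by (cases ?p; cases ?n; cases ?b) auto
  show ?thesis
  proof (cases ?u)
    case (real w)
    with eq pnb 0 have "?a + ennreal n = ennreal (w + p + b)" by simp
    then obtain a where a: "?a = ennreal a" "0 \<le> a" by (cases ?a) auto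
    with \<open>?a + ennreal n = ennreal (w + p + b)\<close> 0 real have "a + n = w + p + b"
      by (simp flip: ennreal_plus)
    then show ?thesis unfolding ereal_integral_def I pnb a(1) real(2) using 0 a real by simp
  next
    case top
    with eq have "?a = top" unfolding pnb by (cases ?a) (auto simp flip: ennreal_plus)
    then show ?thesis unfolding ereal_integral_def I pnb top using 0 by simp
  qed
qed

lemma finite_measure_sum_measure:
  assumes "finite_measure P" "finite_measure Q" "sets Q = sets P"
  shows "finite_measure (sum_measure P Q)"
proof
  interpret P: finite_measure P by fact
  interpret Q: finite_measure Q by fact
  show "emeasure (sum_measure P Q) (space (sum_measure P Q)) \<noteq> \<infinity>"
    using assms(3) by (simp add: emeasure_sum_measure P.emeasure_eq_measure Q.emeasure_eq_measure)
qed

lemma sum_measure_distr: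
  assumes "sets Q = sets P" and [measurable]: "\<phi> \<in> measurable P E"
  shows "sum_measure (distr P E \<phi>) (distr Q E \<phi>) = distr (sum_measure P Q) E \<phi>"
proof (rule measure_eqI)
  have [measurable]: "\<phi> \<in> measurable Q E" "\<phi> \<in> measurable (sum_measure P Q) E"
    using assms(2) measurable_cong_sets[OF assms(1) refl, of E]
      measurable_cong_sets[OF sets_sum_measure refl, of P Q E] by auto
  fix A assume "A \<in> sets (sum_measure (distr P E \<phi>) (distr Q E \<phi>))"
  then have A [measurable]: "A \<in> sets E" by simp
  have "space Q = space P" using assms(1) by (rule sets_eq_imp_space_eq)
  moreover have "\<phi> -` A \<inter> space P \<in> sets P" by measurable
  ultimately show "emeasure (sum_measure (distr P E \<phi>) (distr Q E \<phi>)) A = emeasure (distr (sum_measure P Q) E \<phi>) A"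
    using assms(1) A by (simp add: emeasure_sum_measure emeasure_distr)
qed simp


text \<open>The Radon-Nikodym derivatives of \<open>P\<close> and \<open>Q\<close> with respect to \<open>P + Q\<close> add up to \<open>1\<close>, so real-valued
versions with values in \<open>[0, 1]\<close> exist.\<close>

lemma sum_measure_densities:
  assumes P: "finite_measure P" and Q: "finite_measure Q" and sets: "sets Q = sets P"
  obtains x :: "'a \<Rightarrow> real" where "x \<in> borel_measurable P" "\<And>\<omega>. 0 \<le> x \<omega>" "\<And>\<omega>. x \<omega> \<le> 1"
    "density (sum_measure P Q) (\<lambda>\<omega>. ennreal (x \<omega>)) = P"
    "density (sum_measure P Q) (\<lambda>\<omega>. ennreal (1 - x \<omega>)) = Q"
proof -
  define S where "S = sum_measure P Q"
  interpret S: finite_measure S unfolding S_def by (rule finite_measure_sum_measure[OF assms])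
  have sets_S: "sets S = sets P" by (simp add: S_def)
  have em: "emeasure S A = emeasure P A + emeasure Q A" if "A \<in> sets P" for A
    using that sets by (simp add: S_def emeasure_sum_measure)
  have acP: "absolutely_continuous S P" and acQ: "absolutely_continuous S Q"
    using em by (auto simp: absolutely_continuous_def null_sets_def S_def sets)
  define p where "p = RN_deriv S P"
  define q where "q = RN_deriv S Q"
  have [measurable]: "p \<in> borel_measurable S" "q \<in> borel_measurable S" by (auto simp: p_def q_def)
  have dp: "density S p = P" unfolding p_def by (rule S.density_RN_deriv[OF acP]) (simp add: sets_S)
  have dq: "density S q = Q" unfolding q_def by (rule S.density_RN_deriv[OF acQ]) (simp add: sets_S sets)
  have "density S (\<lambda>\<omega>. p \<omega> + q \<omega>) = density S (\<lambda>\<omega>. 1)"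
  proof (rule measure_eqI)
    fix A assume "A \<in> sets (density S (\<lambda>\<omega>. p \<omega> + q \<omega>))"
    then have [measurable]: "A \<in> sets S" by simp
    have "emeasure (density S (\<lambda>\<omega>. p \<omega> + q \<omega>)) A = emeasure (density S p) A + emeasure (density S q) A"
      by (simp add: emeasure_density distrib_right nn_integral_add)
    then show "emeasure (density S (\<lambda>\<omega>. p \<omega> + q \<omega>)) A = emeasure (density S (\<lambda>\<omega>. 1)) A"
      unfolding dp dq by (simp add: em sets_S[symmetric] emeasure_density)
  qed simp
  then have sum1: "AE \<omega> in S. p \<omega> + q \<omega> = 1"
    by (subst (asm) S.density_unique_iff) auto
  define x where "x = (\<lambda>\<omega>. min 1 (enn2real (p \<omega>)))"
  have [measurable]: "x \<in> borel_measurable S" unfolding x_def by measurable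
  have "AE \<omega> in S. ennreal (x \<omega>) = p \<omega> \<and> ennreal (1 - x \<omega>) = q \<omega>"
    using sum1
  proof eventually_elim
    case (elim \<omega>)
    then obtain a b where "p \<omega> = ennreal a" "0 \<le> a" "q \<omega> = ennreal b" "0 \<le> b"
      by (cases "p \<omega>"; cases "q \<omega>") auto
    with elim have "a + b = 1" by (simp flip: ennreal_plus)
    then have "min 1 a = a" "1 - a = b" using \<open>0 \<le> b\<close> by auto
    then show ?case using \<open>0 \<le> a\<close> by (simp add: x_def \<open>p \<omega> = _\<close> \<open>q \<omega> = _\<close>)
  qed
  then have "AE \<omega> in S. ennreal (x \<omega>) = p \<omega>" "AE \<omega> in S. ennreal (1 - x \<omega>) = q \<omega>" by auto
  then have "density S (\<lambda>\<omega>. ennreal (x \<omega>)) = P" "density S (\<lambda>\<omega>. ennreal (1 - x \<omega>)) = Q"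
    by (auto simp flip: dp dq intro!: density_cong)
  then show ?thesis
    using \<open>x \<in> borel_measurable S\<close> by (intro that[of x]) (auto simp: S_def x_def)
qed

text \<open>With \<open>r = x / (1 - x)\<close>, the part \<open>s (r - 1)\<close> has \<open>Q\<close>-integral \<open>- s \<pi>\<close>, where \<open>\<pi> = P(dP/dQ = \<infinity>)\<close>.
This is exactly compensated by replacing the slope at infinity \<open>l\<close> by \<open>l - s\<close> in the singular term.\<close>

proposition f_divergence_eq_perspective_integral:
  assumes f: "f \<in> divergence_generators" and s: "subgradient f 1 s"
    and P: "prob_space P" and Q: "prob_space Q" and sets: "sets Q = sets P"
    and x: "x \<in> borel_measurable P" and x01: "\<And>\<omega>. 0 \<le> x \<omega>" "\<And>\<omega>. x \<omega> \<le> 1"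
    and dP: "density (sum_measure P Q) (\<lambda>\<omega>. ennreal (x \<omega>)) = P"
    and dQ: "density (sum_measure P Q) (\<lambda>\<omega>. ennreal (1 - x \<omega>)) = Q"
  shows "f_divergence f P Q = enn2ereal (\<integral>\<^sup>+\<omega>. perspective f s (x \<omega>) \<partial>sum_measure P Q)"
proof -
  define S where "S = sum_measure P Q"
  interpret P: prob_space P by fact
  interpret Q: prob_space Q by fact
  interpret S: finite_measure S
    unfolding S_def by (rule finite_measure_sum_measure[OF _ _ sets]) unfold_locales
  have sets_S [measurable_cong]: "sets S = sets P" and sets_Q [measurable_cong]: "sets Q = sets P"
    by (simp_all add: S_def sets)
  note [measurable] = x borel_measurable_generator[OF f] borel_measurable_perspective[OF f]
  have dP: "density S (\<lambda>\<omega>. ennreal (x \<omega>)) = P" and dQ: "density S (\<lambda>\<omega>. ennreal (1 - x \<omega>)) = Q"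
    using dP dQ by (simp_all add: S_def)
  have spaces: "space S = space P" "space Q = space P"
    using sets_S sets_Q by (auto dest: sets_eq_imp_space_eq)
  define r where "r = (\<lambda>\<omega>. x \<omega> / (1 - x \<omega>))"
  have [measurable]: "r \<in> borel_measurable P" unfolding r_def by measurable
  define g where "g = (\<lambda>\<omega>. e2ennreal (f (r \<omega>) - ereal (s * (r \<omega> - 1))))"
  have [measurable]: "g \<in> borel_measurable P" unfolding g_def by measurable
  have [measurable]: "density_ratio P Q \<in> borel_measurable P"
  proof -
    have "RN_deriv S P \<in> borel_measurable P" "RN_deriv S Q \<in> borel_measurable P"
      by measurable
    then show ?thesis unfolding density_ratio_def[abs_def] S_def[symmetric] by measurable
  qed
  have ratio: "AE \<omega> in S. density_ratio P Q \<omega> = ennreal (x \<omega>) / ennreal (1 - x \<omega>)"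
    unfolding S_def
    by (rule density_ratio_eq[of S])
      (use dP dQ S.sigma_finite_measure_axioms P.sigma_finite_measure_axioms Q.sigma_finite_measure_axioms
        in \<open>simp_all\<close>)
  have nonneg: "0 \<le> f u - ereal (s * (u - 1))" for u
  proof -
    have "ereal (s * (u - 1)) \<le> f u" using s generator_1[OF f] by (simp add: subgradient_def)
    then show ?thesis by (cases "f u") auto
  qed
  define \<pi> where "\<pi> = measure S {\<omega> \<in> space P. x \<omega> = 1}"
  have em\<pi>: "emeasure S {\<omega> \<in> space P. x \<omega> = 1} = ennreal \<pi>"
    by (simp add: \<pi>_def S.emeasure_eq_measure)

  have "AE \<omega> in S. 0 < ennreal (1 - x \<omega>) \<longrightarrow> enn2real (density_ratio P Q \<omega>) = r \<omega>"
    using ratio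
  proof eventually_elim
    case (elim \<omega>)
    then show ?case using x01[of \<omega>]
      by (auto simp: r_def divide_ennreal)
  qed
  then have rQ: "AE \<omega> in Q. enn2real (density_ratio P Q \<omega>) = r \<omega>"
    by (subst dQ[symmetric], subst AE_density) auto

  have int_x: "integrable S x" by (rule S.integrable_const_bound[of _ 1]) (use x01 in auto)
  have int_ind: "integrable S (indicator {\<omega> \<in> space P. x \<omega> = 1} :: _ \<Rightarrow> real)"
    by (rule S.integrable_const_bound[of _ 1]) (auto simp: indicator_def)
  have xr: "AE \<omega> in S. (1 - x \<omega>) * r \<omega> = x \<omega> - indicator {\<omega> \<in> space P. x \<omega> = 1} \<omega>"
    by (rule AE_I2) (auto simp: r_def spaces indicator_def)
  have "integrable S (\<lambda>\<omega>. (1 - x \<omega>) * r \<omega>)"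
    by (subst integrable_cong_AE[OF _ _ xr]) (use int_x int_ind in auto)
  then have int_r: "integrable Q r"
    by (subst dQ[symmetric], subst integrable_real_density) (use x01 in auto)
  have "(\<integral>\<^sup>+\<omega>. ennreal (x \<omega>) \<partial>S) = emeasure (density S (\<lambda>\<omega>. ennreal (x \<omega>))) (space S)"
    by (simp add: emeasure_density cong: nn_integral_cong)
  then have "(\<integral>\<^sup>+\<omega>. ennreal (x \<omega>) \<partial>S) = 1"
    by (simp only: dP spaces P.emeasure_space_1)
  then have int_x1: "(\<integral>\<omega>. x \<omega> \<partial>S) = 1"
    by (simp add: integral_eq_nn_integral x01)
  have "(\<integral>\<omega>. r \<omega> \<partial>Q) = (\<integral>\<omega>. (1 - x \<omega>) * r \<omega> \<partial>S)"
    by (subst dQ[symmetric], subst integral_real_density) (use x01 in auto)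
  also have "\<dots> = (\<integral>\<omega>. x \<omega> - indicator {\<omega> \<in> space P. x \<omega> = 1} \<omega> \<partial>S)"
    by (rule integral_cong_AE[OF _ _ xr]) auto
  also have "\<dots> = 1 - \<pi>"
    using int_x int_ind int_x1 by (simp add: \<pi>_def)
  finally have int_r1: "(\<integral>\<omega>. r \<omega> \<partial>Q) = 1 - \<pi>" .

  have int_Q: "ereal_integral Q (\<lambda>\<omega>. f (enn2real (density_ratio P Q \<omega>)))
      = enn2ereal (\<integral>\<^sup>+\<omega>. g \<omega> \<partial>Q) + ereal (\<integral>\<omega>. s * (r \<omega> - 1) \<partial>Q)"
  proof (rule ereal_integral_decompose)
    show "integrable Q (\<lambda>\<omega>. s * (r \<omega> - 1))" using int_r by auto
    show "AE \<omega> in Q. f (enn2real (density_ratio P Q \<omega>)) = enn2ereal (g \<omega>) + ereal (s * (r \<omega> - 1))"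
      using rQ
    proof eventually_elim
      case (elim \<omega>)
      show ?case unfolding elim g_def enn2ereal_e2ennreal[OF nonneg]
        by (cases "f (r \<omega>)") auto
    qed
  qed measurable
  have int_s: "(\<integral>\<omega>. s * (r \<omega> - 1) \<partial>Q) = - (s * \<pi>)"
    using int_r int_r1 by (simp add: Q.prob_space)

  have "AE \<omega> in S. ennreal (x \<omega>) * indicator {\<omega> \<in> space P. density_ratio P Q \<omega> = \<infinity>} \<omega>
      = indicator {\<omega> \<in> space P. x \<omega> = 1} \<omega>"
    using ratio
  proof eventually_elim
    case (elim \<omega>)
    then show ?case using x01[of \<omega>]
      by (cases "x \<omega> = 1") (auto simp: indicator_def divide_ennreal)
  qed
  then have "(\<integral>\<^sup>+\<omega>. ennreal (x \<omega>) * indicator {\<omega> \<in> space P. density_ratio P Q \<omega> = \<infinity>} \<omega> \<partial>S)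
      = (\<integral>\<^sup>+\<omega>. indicator {\<omega> \<in> space P. x \<omega> = 1} \<omega> \<partial>S)"
    by (rule nn_integral_cong_AE)
  then have "emeasure (density S (\<lambda>\<omega>. ennreal (x \<omega>))) {\<omega> \<in> space P. density_ratio P Q \<omega> = \<infinity>} = ennreal \<pi>"
    by (subst emeasure_density) (auto simp: em\<pi>)
  then have mP: "measure P {\<omega> \<in> space P. density_ratio P Q \<omega> = \<infinity>} = \<pi>"
    unfolding dP by (simp add: measure_def \<pi>_def)

  define c where "c = e2ennreal (slope_at_infinity f - ereal s)"
  have "(\<integral>\<^sup>+\<omega>. perspective f s (x \<omega>) \<partial>S)
      = (\<integral>\<^sup>+\<omega>. ennreal (1 - x \<omega>) * g \<omega> + c * indicator {\<omega> \<in> space P. x \<omega> = 1} \<omega> \<partial>S)"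
    by (rule nn_integral_cong) (auto simp: perspective_def g_def r_def c_def indicator_def spaces)
  also have "\<dots> = (\<integral>\<^sup>+\<omega>. ennreal (1 - x \<omega>) * g \<omega> \<partial>S) + c * ennreal \<pi>"
    by (subst nn_integral_add) (auto simp: nn_integral_cmult em\<pi>)
  also have "(\<integral>\<^sup>+\<omega>. ennreal (1 - x \<omega>) * g \<omega> \<partial>S) = (\<integral>\<^sup>+\<omega>. g \<omega> \<partial>Q)"
    by (subst dQ[symmetric], subst nn_integral_density) auto
  finally have int_S: "(\<integral>\<^sup>+\<omega>. perspective f s (x \<omega>) \<partial>S) = (\<integral>\<^sup>+\<omega>. g \<omega> \<partial>Q) + c * ennreal \<pi>" .

  have \<pi>0: "0 \<le> \<pi>" by (simp add: \<pi>_def)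
  have slope: "ereal s \<le> slope_at_infinity f"
    using generator_interior[OF f] interior_subset
    by (intro subgradient_le_slope_at_infinity[OF f s]) auto
  have "ereal (- (s * \<pi>)) + slope_at_infinity f * ereal \<pi> = enn2ereal (c * ennreal \<pi>)"
  proof (cases "slope_at_infinity f")
    case (real d)
    then have "0 \<le> (d - s) * \<pi>" using slope \<pi>0 by simp
    with real show ?thesis using slope \<pi>0
      by (simp add: c_def algebra_simps flip: ennreal_mult)
  next
    case PInf
    then show ?thesis using \<pi>0
      by (cases "\<pi> = 0") (auto simp: c_def ennreal_top_mult zero_ennreal.rep_eq)
  qed (use slope in auto)
  then show ?thesis
    unfolding f_divergence_def int_Q int_s mP int_S[unfolded S_def]
    by (simp add: plus_ennreal.rep_eq add.assoc)
qed

section \<open>Conditional expectations and the ratio of the push-forwards\<close>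

text \<open>Bayes' rule for conditional expectations under a change of measure.  It is stated as a product,
since \<open>nn_cond_exp M F q\<close> may vanish.\<close>

lemma nn_cond_exp_density:
  assumes M: "finite_measure M" and F: "subalgebra M F"
    and [measurable]: "q \<in> borel_measurable M" "g \<in> borel_measurable M"
    and fin: "finite_measure (density M q)"
  shows "AE x in M. nn_cond_exp (density M q) F g x * nn_cond_exp M F q x
    = nn_cond_exp M F (\<lambda>x. g x * q x) x"
proof -
  interpret M: finite_measure_subalgebra M F
    using M F by (simp add: finite_measure_subalgebra_def finite_measure_subalgebra_axioms_def)
  interpret D: finite_measure_subalgebra "density M q" F
    using fin F by (simp add: finite_measure_subalgebra_def finite_measure_subalgebra_axioms_def subalgebra_def)
  let ?v = "nn_cond_exp (density M q) F g"
  have vM [measurable]: "?v \<in> borel_measurable M"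
    using F by (rule measurable_from_subalg) simp
  show ?thesis
  proof (rule M.nn_cond_exp_charact)
    fix A assume A [measurable]: "A \<in> sets F"
    have [measurable]: "A \<in> sets M" using F A by (auto simp: subalgebra_def)
    have "(\<integral>\<^sup>+x\<in>A. g x * q x \<partial>M) = (\<integral>\<^sup>+x. indicator A x * g x \<partial>density M q)"
      by (subst nn_integral_density) (auto simp: ac_simps)
    also have "\<dots> = (\<integral>\<^sup>+x. indicator A x * ?v x \<partial>density M q)"
      by (rule D.nn_cond_exp_intg[symmetric]) auto
    also have "\<dots> = (\<integral>\<^sup>+x. (indicator A x * ?v x) * q x \<partial>M)"
      by (subst nn_integral_density) (auto simp: ac_simps)
    also have "\<dots> = (\<integral>\<^sup>+x. (indicator A x * ?v x) * nn_cond_exp M F q x \<partial>M)"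
      by (rule M.nn_cond_exp_intg[symmetric]) auto
    finally show "(\<integral>\<^sup>+x\<in>A. g x * q x \<partial>M) = (\<integral>\<^sup>+x\<in>A. ?v x * nn_cond_exp M F q x \<partial>M)"
      by (simp add: ac_simps)
  qed auto
qed

lemma subalgebra_vimage_algebra:
  assumes "\<phi> \<in> measurable M E"
  shows "subalgebra M (vimage_algebra (space M) \<phi> E)"
  using assms by (auto simp: subalgebra_def sets_vimage_algebra2 measurable_space measurable_sets)

text \<open>The density of a push-forward, composed with the map, is the conditional expectation of the
density.\<close>

lemma nn_cond_exp_vimage_density:
  assumes M: "finite_measure M" and [measurable]: "\<phi> \<in> measurable M E" "p \<in> borel_measurable M"
    "p' \<in> borel_measurable E"
    and dens: "distr (density M p) E \<phi> = density (distr M E \<phi>) p'"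
  shows "AE x in M. nn_cond_exp M (vimage_algebra (space M) \<phi> E) p x = p' (\<phi> x)"
proof -
  define F where "F = vimage_algebra (space M) \<phi> E"
  have sub: "subalgebra M F" unfolding F_def by (rule subalgebra_vimage_algebra) measurable
  interpret finite_measure_subalgebra M F
    using M sub by (simp add: finite_measure_subalgebra_def finite_measure_subalgebra_axioms_def)
  have sp: "\<phi> \<in> space M \<rightarrow> space E" using measurable_space[OF assms(2)] by auto
  have \<phi>F [measurable]: "\<phi> \<in> measurable F E" unfolding F_def by (rule measurable_vimage_algebra1[OF sp])
  have "AE x in M. p' (\<phi> x) = nn_cond_exp M F p x"
  proof (rule nn_cond_exp_charact)
    fix A assume "A \<in> sets F"
    then obtain C where C [measurable]: "C \<in> sets E" and A: "A = \<phi> -` C \<inter> space M"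
      by (auto simp: F_def sets_vimage_algebra2[OF sp])
    have "(\<integral>\<^sup>+x\<in>A. p x \<partial>M) = emeasure (density M p) (\<phi> -` C \<inter> space M)"
      unfolding A by (subst emeasure_density) auto
    also have "\<dots> = emeasure (distr (density M p) E \<phi>) C"
      by (subst emeasure_distr) auto
    also have "\<dots> = (\<integral>\<^sup>+x. p' (\<phi> x) * indicator C (\<phi> x) \<partial>M)"
      unfolding dens by (subst emeasure_density) (auto simp: nn_integral_distr)
    also have "\<dots> = (\<integral>\<^sup>+x\<in>A. p' (\<phi> x) \<partial>M)"
      by (rule nn_integral_cong) (auto simp: A indicator_def)
    finally show "(\<integral>\<^sup>+x\<in>A. p x \<partial>M) = (\<integral>\<^sup>+x\<in>A. p' (\<phi> x) \<partial>M)" .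
  qed auto
  then show ?thesis unfolding F_def by eventually_elim simp
qed

text \<open>On the \<open>F\<close>-measurable set where the conditional expectation of \<open>g\<close> vanishes, \<open>g\<close> itself vanishes
almost everywhere, hence so do \<open>h\<close> and its conditional expectation.\<close>

lemma (in sigma_finite_subalgebra) nn_cond_exp_pos_mono:
  assumes [measurable]: "g \<in> borel_measurable M" "h \<in> borel_measurable M"
    and gh: "AE x in M. g x = 0 \<longrightarrow> h x = 0"
  shows "AE x in M. 0 < nn_cond_exp M F h x \<longrightarrow> 0 < nn_cond_exp M F g x"
proof -
  define A where "A = {x \<in> space F. nn_cond_exp M F g x = 0}"
  have [measurable]: "A \<in> sets F" unfolding A_def by measurable
  have [measurable]: "A \<in> sets M" using subalg \<open>A \<in> sets F\<close> by (auto simp: subalgebra_def)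
  have [measurable]: "nn_cond_exp M F h \<in> borel_measurable M"
    using subalg by (rule measurable_from_subalg) simp
  have "(\<integral>\<^sup>+x. indicator A x * g x \<partial>M) = (\<integral>\<^sup>+x. indicator A x * nn_cond_exp M F g x \<partial>M)"
    by (rule nn_cond_exp_intg[symmetric]) auto
  also have "\<dots> = (\<integral>\<^sup>+x. 0 \<partial>M)"
    by (rule nn_integral_cong) (auto simp: A_def indicator_def)
  also have "\<dots> = 0" by simp
  finally have "AE x in M. indicator A x * g x = 0"
    by (subst (asm) nn_integral_0_iff_AE) auto
  with gh have "AE x in M. indicator A x * h x = 0"
    by eventually_elim (auto simp: indicator_def split: if_splits)
  then have "(\<integral>\<^sup>+x. indicator A x * h x \<partial>M) = 0"
    by (subst nn_integral_0_iff_AE) auto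
  then have "(\<integral>\<^sup>+x. indicator A x * nn_cond_exp M F h x \<partial>M) = 0"
    by (subst nn_cond_exp_intg) auto
  then have "AE x in M. indicator A x * nn_cond_exp M F h x = 0"
    by (subst (asm) nn_integral_0_iff_AE) auto
  then show ?thesis using AE_space
    by eventually_elim (use subalg in \<open>auto simp: A_def indicator_def subalgebra_def zero_less_iff_neq_zero split: if_splits\<close>)
qed

lemma distr_density_obtain:
  assumes M: "finite_measure M" and [measurable]: "\<phi> \<in> measurable M E" "p \<in> borel_measurable M"
  obtains p' where "p' \<in> borel_measurable E" "distr (density M p) E \<phi> = density (distr M E \<phi>) p'"
proof -
  interpret M: finite_measure M by fact
  interpret D: finite_measure "distr M E \<phi>" by (rule M.finite_measure_distr) measurable
  have "absolutely_continuous (distr M E \<phi>) (distr (density M p) E \<phi>)"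
    using absolutely_continuousI_density[of p M]
    by (auto simp: absolutely_continuous_def null_sets_def emeasure_distr subset_eq)
  from D.density_RN_deriv[OF this]
  show ?thesis by (intro that[of "RN_deriv (distr M E \<phi>) (distr (density M p) E \<phi>)"]) auto
qed

text \<open>The conditional expectations under \<open>Q\<close> and \<open>P\<close> are determined only \<open>Q\<close>- and \<open>P\<close>-almost everywhere.
Multiplication by the densities \<open>q'\<close> and \<open>p'\<close> turns both into \<open>u\<close>, which is determined
\<open>L\<close>-almost everywhere.  The last hypothesis says that \<open>L\<close> charges no \<open>(P + Q)\<close>-null set.\<close>

proposition density_ratio_distr_eq:
  assumes L: "finite_measure L" and P: "prob_space P" and Q: "prob_space Q"
    and \<phi> [measurable]: "\<phi> \<in> measurable L E"
    and pq [measurable]: "p \<in> borel_measurable L" "q \<in> borel_measurable L"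
    and dP: "P = density L p" and dQ: "Q = density L q"
    and AE_L: "\<And>R. (AE x in sum_measure P Q. R x) \<Longrightarrow> (AE x in L. R x)"
  shows "AE x in L. nn_cond_exp_given L \<phi> E (\<lambda>y. p y * q y) x > 0 \<longrightarrow>
         density_ratio (distr P E \<phi>) (distr Q E \<phi>) (\<phi> x) =
           nn_cond_exp_given Q \<phi> E (density_ratio P Q) x /
           cond_prob_given P \<phi> E {y \<in> space P. density_ratio P Q y < \<infinity>} x \<and>
         nn_cond_exp_given Q \<phi> E (density_ratio P Q) x /
           cond_prob_given P \<phi> E {y \<in> space P. density_ratio P Q y < \<infinity>} x \<in> {0<..<\<infinity>}"
proof -
  interpret L: finite_measure L by fact
  interpret P: prob_space P by fact
  interpret Q: prob_space Q by fact
  have sets [measurable_cong]: "sets P = sets L" "sets Q = sets L" by (simp_all add: dP dQ)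
  have spaces: "space P = space L" "space Q = space L" by (simp_all add: dP dQ)
  define F where "F = vimage_algebra (space L) \<phi> E"
  have F: "subalgebra L F" unfolding F_def by (rule subalgebra_vimage_algebra) measurable
  interpret L: finite_measure_subalgebra L F
    using L F by (simp add: finite_measure_subalgebra_def finite_measure_subalgebra_axioms_def)
  define r where "r = density_ratio P Q"
  have [measurable]: "r \<in> borel_measurable L"
  proof -
    have "RN_deriv (sum_measure P Q) P \<in> borel_measurable L" "RN_deriv (sum_measure P Q) Q \<in> borel_measurable L"
      by measurable
    then show ?thesis unfolding r_def density_ratio_def[abs_def] by measurable
  qed
  define J where "J = {y \<in> space L. r y < \<infinity>}"
  have [measurable]: "J \<in> sets L" unfolding J_def by measurable

  have fin_pq: "AE x in L. p x \<noteq> \<infinity> \<and> q x \<noteq> \<infinity>"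
    using P.sigma_finite_measure_axioms Q.sigma_finite_measure_axioms
      L.sigma_finite_iff_density_finite[OF pq(1)] L.sigma_finite_iff_density_finite[OF pq(2)]
    by (auto simp: dP dQ)
  have r: "AE x in L. r x = p x / q x"
    unfolding r_def
    by (rule AE_L, rule density_ratio_eq[of L])
      (use L.sigma_finite_measure_axioms dP dQ P.sigma_finite_measure_axioms Q.sigma_finite_measure_axioms in auto)
  define m where "m = (\<lambda>x. if q x = 0 then 0 else p x)"
  have [measurable]: "m \<in> borel_measurable L" unfolding m_def by measurable
  have rm: "AE x in L. r x * q x = m x \<and> indicator J x * p x = m x"
    using fin_pq r AE_space
  proof eventually_elim
    case (elim x)
    show ?case
    proof (cases "q x = 0")
      case True
      then show ?thesis using elim
        by (cases "p x = 0") (auto simp: J_def m_def indicator_def)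
    next
      case False
      obtain a where a: "p x = ennreal a" "0 \<le> a"
        using elim by (cases "p x") auto
      obtain b where b: "q x = ennreal b" "0 < b"
        using elim False by (cases "q x") (auto simp: le_less)
      have "r x = ennreal (a / b)" using elim a b by (simp add: divide_ennreal)
      moreover have "ennreal (a / b) * ennreal b = ennreal a"
        using a b by (simp flip: ennreal_mult)
      ultimately show ?thesis using a b elim(3) by (simp add: J_def m_def)
    qed
  qed

  obtain p' where p' [measurable]: "p' \<in> borel_measurable E" "distr P E \<phi> = density (distr L E \<phi>) p'"
    unfolding dP by (rule distr_density_obtain[OF L \<phi> pq(1)])
  obtain q' where q' [measurable]: "q' \<in> borel_measurable E" "distr Q E \<phi> = density (distr L E \<phi>) q'"
    unfolding dQ by (rule distr_density_obtain[OF L \<phi> pq(2)])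
  interpret L': finite_measure "distr L E \<phi>" by (rule L.finite_measure_distr) measurable
  interpret P': prob_space "distr P E \<phi>" by (rule P.prob_space_distr) measurable
  interpret Q': prob_space "distr Q E \<phi>" by (rule Q.prob_space_distr) measurable
  have "AE e in sum_measure (distr P E \<phi>) (distr Q E \<phi>). density_ratio (distr P E \<phi>) (distr Q E \<phi>) e = p' e / q' e"
    by (rule density_ratio_eq[of "distr L E \<phi>"])
      (use p' q' L'.sigma_finite_measure_axioms P'.sigma_finite_measure_axioms
        Q'.sigma_finite_measure_axioms in auto)
  then have "AE e in distr (sum_measure P Q) E \<phi>. density_ratio (distr P E \<phi>) (distr Q E \<phi>) e = p' e / q' e"
    by (subst sum_measure_distr[symmetric]) (auto simp: sets)
  then have "AE x in sum_measure P Q. density_ratio (distr P E \<phi>) (distr Q E \<phi>) (\<phi> x) = p' (\<phi> x) / q' (\<phi> x)"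
    by (rule AE_distrD[rotated]) measurable
  note ratio' = AE_L[OF this]
  have "AE e in distr L E \<phi>. p' e \<noteq> \<infinity> \<and> q' e \<noteq> \<infinity>"
    using P'.sigma_finite_measure_axioms Q'.sigma_finite_measure_axioms
      L'.sigma_finite_iff_density_finite[of p'] L'.sigma_finite_iff_density_finite[of q'] p' q'
    by auto
  then have fin': "AE x in L. p' (\<phi> x) \<noteq> \<infinity> \<and> q' (\<phi> x) \<noteq> \<infinity>"
    by (rule AE_distrD[rotated]) measurable

  have p'_cond: "AE x in L. nn_cond_exp L F p x = p' (\<phi> x)"
    unfolding F_def by (rule nn_cond_exp_vimage_density[OF L]) (use p' dP in auto)
  have q'_cond: "AE x in L. nn_cond_exp L F q x = q' (\<phi> x)"
    unfolding F_def by (rule nn_cond_exp_vimage_density[OF L]) (use q' dQ in auto)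
  define v where "v = nn_cond_exp Q F r"
  define w where "w = nn_cond_exp P F (indicator J)"
  define u where "u = nn_cond_exp L F m"
  have "AE x in L. v x * nn_cond_exp L F q x = nn_cond_exp L F (\<lambda>x. r x * q x) x"
    unfolding v_def dQ
    by (rule nn_cond_exp_density[OF L F]) (use Q.finite_measure_axioms dQ in auto)
  moreover have "AE x in L. nn_cond_exp L F (\<lambda>x. r x * q x) x = u x"
    unfolding u_def by (rule L.nn_cond_exp_cong) (use rm in auto)
  ultimately have v: "AE x in L. v x * q' (\<phi> x) = u x"
    using q'_cond by eventually_elim simp
  have "AE x in L. w x * nn_cond_exp L F p x = nn_cond_exp L F (\<lambda>x. indicator J x * p x) x"
    unfolding w_def dP
    by (rule nn_cond_exp_density[OF L F]) (use P.finite_measure_axioms dP in auto)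
  moreover have "AE x in L. nn_cond_exp L F (\<lambda>x. indicator J x * p x) x = u x"
    unfolding u_def by (rule L.nn_cond_exp_cong) (use rm in auto)
  ultimately have w: "AE x in L. w x * p' (\<phi> x) = u x"
    using p'_cond by eventually_elim simp
  have "AE x in L. u x \<le> nn_cond_exp L F p x"
    unfolding u_def by (rule L.nn_cond_exp_mono) (auto simp: m_def)
  then have u_le: "AE x in L. u x \<le> p' (\<phi> x)" using p'_cond by eventually_elim simp
  have pos: "AE x in L. 0 < nn_cond_exp L F (\<lambda>y. p y * q y) x \<longrightarrow> 0 < u x"
    unfolding u_def by (rule L.nn_cond_exp_pos_mono) (auto simp: m_def)

  have defs: "nn_cond_exp_given L \<phi> E (\<lambda>y. p y * q y) = nn_cond_exp L F (\<lambda>y. p y * q y)"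
    "nn_cond_exp_given Q \<phi> E (density_ratio P Q) = v"
    "cond_prob_given P \<phi> E {y \<in> space P. density_ratio P Q y < \<infinity>} = w"
    by (simp_all add: nn_cond_exp_given_def cond_prob_given_def F_def v_def w_def J_def r_def spaces)
  show ?thesis
    unfolding defs using ratio' fin' v w u_le pos
  proof eventually_elim
    case (elim x)
    show ?case
    proof
      assume "0 < nn_cond_exp L F (\<lambda>y. p y * q y) x"
      with elim have u0: "0 < u x" by simp
      with elim obtain a where a: "u x = ennreal a" "0 < a"
        by (cases "u x") (auto simp: top_unique)
      obtain b where b: "p' (\<phi> x) = ennreal b" "0 < b"
        using elim u0 by (cases "p' (\<phi> x)") (auto simp: le_less)
      obtain c where c: "q' (\<phi> x) = ennreal c" "0 < c"
        using elim u0 by (cases "q' (\<phi> x)") (auto simp: le_less)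
      obtain d where d: "v x = ennreal d" "0 \<le> d"
        using elim a c by (cases "v x") (auto simp: ennreal_top_mult)
      obtain e where e: "w x = ennreal e" "0 \<le> e"
        using elim a b by (cases "w x") (auto simp: ennreal_top_mult)
      have de: "d * c = a" "e * b = a"
        using elim a b c d e by (auto simp flip: ennreal_mult simp: less_imp_le)
      then have "0 < d" "0 < e" using a b c d e by (auto simp: le_less)
      have "b / c = d / e" using de b c \<open>0 < e\<close> by (simp add: field_simps)
      then show "density_ratio (distr P E \<phi>) (distr Q E \<phi>) (\<phi> x) = v x / w x \<and> v x / w x \<in> {0<..<\<infinity>}"
        using elim b c d e \<open>0 < d\<close> \<open>0 < e\<close> by (simp add: divide_ennreal)
    qed
  qed
qed

section \<open>Data processing and its equality case\<close>

text \<open>Both divergences become integrals of the same perspective over the same space, at the density \<open>x\<close> and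
at its conditional expectation \<open>y \<circ> \<phi>\<close>.\<close>

lemma pushforward_representation:
  assumes P: "prob_space P" and Q: "prob_space Q" and sets: "sets Q = sets P"
    and \<phi>: "\<phi> \<in> measurable P E"
  obtains x y where "pushforward_density (sum_measure P Q) E \<phi> x y"
    "AE \<omega> in sum_measure P Q. density_ratio P Q \<omega> = ennreal (x \<omega>) / ennreal (1 - x \<omega>)"
    "\<And>f s. f \<in> divergence_generators \<Longrightarrow> subgradient f 1 s \<Longrightarrow>
       f_divergence f P Q = enn2ereal (\<integral>\<^sup>+\<omega>. perspective f s (x \<omega>) \<partial>sum_measure P Q)"
    "\<And>f s. f \<in> divergence_generators \<Longrightarrow> subgradient f 1 s \<Longrightarrow>
       f_divergence f (distr P E \<phi>) (distr Q E \<phi>)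
         = enn2ereal (\<integral>\<^sup>+\<omega>. perspective f s (y (\<phi> \<omega>)) \<partial>sum_measure P Q)"
proof -
  interpret P: prob_space P by fact
  interpret Q: prob_space Q by fact
  define S where "S = sum_measure P Q"
  interpret S: finite_measure S
    unfolding S_def by (rule finite_measure_sum_measure[OF _ _ sets]) unfold_locales
  have \<phi>Q: "\<phi> \<in> measurable Q E" using \<phi> measurable_cong_sets[OF sets refl, of E] by simp
  have \<phi>S: "\<phi> \<in> measurable S E"
    using \<phi> measurable_cong_sets[OF sets_sum_measure refl, of P Q E] by (simp add: S_def)
  note P' = P.prob_space_distr[OF \<phi>] and Q' = Q.prob_space_distr[OF \<phi>Q]
  have sets': "sets (distr Q E \<phi>) = sets (distr P E \<phi>)" by simp
  have S': "sum_measure (distr P E \<phi>) (distr Q E \<phi>) = distr S E \<phi>"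
    unfolding S_def by (rule sum_measure_distr[OF sets \<phi>])
  obtain x where x: "x \<in> borel_measurable P" "\<And>\<omega>. 0 \<le> x \<omega>" "\<And>\<omega>. x \<omega> \<le> 1"
    "density S (\<lambda>\<omega>. ennreal (x \<omega>)) = P" "density S (\<lambda>\<omega>. ennreal (1 - x \<omega>)) = Q"
    unfolding S_def using sum_measure_densities[OF P.finite_measure_axioms Q.finite_measure_axioms sets] by blast
  obtain y where y: "y \<in> borel_measurable (distr P E \<phi>)" "\<And>e. 0 \<le> y e" "\<And>e. y e \<le> 1"
    "density (distr S E \<phi>) (\<lambda>e. ennreal (y e)) = distr P E \<phi>"
    "density (distr S E \<phi>) (\<lambda>e. ennreal (1 - y e)) = distr Q E \<phi>"
    unfolding S'[symmetric]
    using sum_measure_densities[OF prob_space.finite_measure[OF P'] prob_space.finite_measure[OF Q'] sets']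
    by blast
  have yE: "y \<in> borel_measurable E" using y(1) by simp
  have xS: "x \<in> borel_measurable S"
    using x(1) measurable_cong_sets[OF sets_sum_measure refl, of P Q borel] by (simp add: S_def)
  show ?thesis
  proof (rule that[of x y, folded S_def])
    show "pushforward_density S E \<phi> x y"
      by unfold_locales (use x y xS yE \<phi>S in simp_all)
    show "AE \<omega> in S. density_ratio P Q \<omega> = ennreal (x \<omega>) / ennreal (1 - x \<omega>)"
      unfolding S_def
      by (rule density_ratio_eq[of S])
        (use x xS S.sigma_finite_measure_axioms P.sigma_finite_measure_axioms Q.sigma_finite_measure_axioms
          in simp_all)
  next
    fix f s assume f: "f \<in> divergence_generators" and s: "subgradient f 1 s"
    show "f_divergence f P Q = enn2ereal (\<integral>\<^sup>+\<omega>. perspective f s (x \<omega>) \<partial>S)"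
      unfolding S_def
      by (rule f_divergence_eq_perspective_integral[OF f s P Q sets]) (use x in \<open>simp_all add: S_def\<close>)
  next
    fix f s assume f: "f \<in> divergence_generators" and s: "subgradient f 1 s"
    have "f_divergence f (distr P E \<phi>) (distr Q E \<phi>) = enn2ereal (\<integral>\<^sup>+e. perspective f s (y e) \<partial>distr S E \<phi>)"
      unfolding S'[symmetric]
      by (rule f_divergence_eq_perspective_integral[OF f s P' Q' sets']) (use y in \<open>simp_all add: S'\<close>)
    also have "(\<integral>\<^sup>+e. perspective f s (y e) \<partial>distr S E \<phi>) = (\<integral>\<^sup>+\<omega>. perspective f s (y (\<phi> \<omega>)) \<partial>S)"
      using measurable_compose[OF yE borel_measurable_perspective[OF f]]
      by (subst nn_integral_distr[OF \<phi>S]) simp_all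
    finally show "f_divergence f (distr P E \<phi>) (distr Q E \<phi>) = enn2ereal (\<integral>\<^sup>+\<omega>. perspective f s (y (\<phi> \<omega>)) \<partial>S)" .
  qed
qed

context pushforward_density
begin

lemma perspective_integral_le:
  assumes f: "f \<in> divergence_generators" and s: "subgradient f 1 s"
  shows "(\<integral>\<^sup>+\<omega>. perspective f s (y (\<phi> \<omega>)) \<partial>M) \<le> (\<integral>\<^sup>+\<omega>. perspective f s (X \<omega>) \<partial>M)"
proof (cases "(\<integral>\<^sup>+\<omega>. perspective f s (X \<omega>) \<partial>M) < \<infinity>")
  case True
  show ?thesis
  proof (rule perspective_supporting_slopes[OF f s])
    fix c d k
    assume cd: "0 \<le> c" "d \<le> 1"
      and range: "\<And>x. 0 \<le> x \<Longrightarrow> x \<le> 1 \<Longrightarrow> perspective f s x < \<infinity> \<Longrightarrow> c \<le> x \<and> x \<le> d"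
      and inside: "\<And>a. c < a \<Longrightarrow> a < d \<Longrightarrow> perspective f s a < \<infinity>"
      and supp: "\<And>a x. c < a \<Longrightarrow> a < d \<Longrightarrow> 0 \<le> x \<Longrightarrow> x \<le> 1 \<Longrightarrow> perspective f s x < \<infinity> \<Longrightarrow>
        enn2real (perspective f s a) + k a * (x - a) \<le> enn2real (perspective f s x)"
    show ?thesis
    proof (rule jensen_defect[OF borel_measurable_perspective[OF f] True range inside cd supp])
      fix G
      assume "(\<integral>\<^sup>+\<omega>. perspective f s (X \<omega>) \<partial>M)
        = (\<integral>\<^sup>+\<omega>. perspective f s (y (\<phi> \<omega>)) \<partial>M) + (\<integral>\<^sup>+\<omega>. G \<omega> \<partial>M)"
      then show ?thesis by simp
    qed
  qed
next
  case False
  then have "(\<integral>\<^sup>+\<omega>. perspective f s (X \<omega>) \<partial>M) = top" by (simp flip: less_top)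
  then show ?thesis by simp
qed

lemma perspective_integral_eq_imp:
  assumes f: "f \<in> divergence_generators" and s: "subgradient f 1 s"
    and sc: "strictly_convex_on f {0<..}"
    and fin: "(\<integral>\<^sup>+\<omega>. perspective f s (X \<omega>) \<partial>M) < \<infinity>"
    and eq: "(\<integral>\<^sup>+\<omega>. perspective f s (y (\<phi> \<omega>)) \<partial>M) = (\<integral>\<^sup>+\<omega>. perspective f s (X \<omega>) \<partial>M)"
  shows "AE \<omega> in M. X \<omega> = y (\<phi> \<omega>)"
proof (rule perspective_supporting_slopes[OF f s])
  fix c d k
  assume cd: "0 \<le> c" "d \<le> 1"
    and range: "\<And>x. 0 \<le> x \<Longrightarrow> x \<le> 1 \<Longrightarrow> perspective f s x < \<infinity> \<Longrightarrow> c \<le> x \<and> x \<le> d"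
    and inside: "\<And>a. c < a \<Longrightarrow> a < d \<Longrightarrow> perspective f s a < \<infinity>"
    and supp: "\<And>a x. strictly_convex_on f {0<..} \<Longrightarrow> c < a \<Longrightarrow> a < d \<Longrightarrow> 0 \<le> x \<Longrightarrow> x \<le> 1 \<Longrightarrow>
      perspective f s x < \<infinity> \<Longrightarrow> x \<noteq> a \<Longrightarrow>
      enn2real (perspective f s a) + k a * (x - a) < enn2real (perspective f s x)"
  show ?thesis
    by (rule jensen_strict[OF borel_measurable_perspective[OF f] fin range inside cd supp[OF sc] eq])
qed

text \<open>The ratio \<open>X / (1 - X)\<close> determines \<open>X\<close>, so \<open>X\<close> is a function \<open>k\<close> of \<open>\<phi>\<close>.  Then \<open>k\<close> is a density of the
push-forward as well, and densities are unique.\<close>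

lemma density_factors:
  fixes h :: "'b \<Rightarrow> ennreal"
  assumes [measurable]: "h \<in> borel_measurable E"
    and h: "AE \<omega> in M. ennreal (X \<omega>) / ennreal (1 - X \<omega>) = h (\<phi> \<omega>)"
  shows "AE \<omega> in M. X \<omega> = y (\<phi> \<omega>)"
proof -
  define k where "k = (\<lambda>e. if h e = \<infinity> then 1 else enn2real (h e) / (1 + enn2real (h e)))"
  have [measurable]: "k \<in> borel_measurable E" unfolding k_def by measurable
  have Xk: "AE \<omega> in M. X \<omega> = k (\<phi> \<omega>)"
    using h
  proof eventually_elim
    case (elim \<omega>)
    show ?case
    proof (cases "X \<omega> = 1")
      case True
      with elim have "h (\<phi> \<omega>) = \<infinity>" by simp
      with True show ?thesis by (simp add: k_def)
    next
      case False
      then have lt: "X \<omega> < 1" using X01[of \<omega>] by simp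
      then have "h (\<phi> \<omega>) = ennreal (X \<omega> / (1 - X \<omega>))"
        using elim X01[of \<omega>] by (simp add: divide_ennreal)
      then show ?thesis using lt X01[of \<omega>] by (simp add: k_def field_simps)
    qed
  qed
  interpret N: finite_measure "distr M E \<phi>" by (rule finite_measure_distr) measurable
  have "density (distr M E \<phi>) (\<lambda>e. ennreal (y e)) = distr (density M (\<lambda>\<omega>. ennreal (X \<omega>))) E \<phi>"
    by (rule dens[symmetric])
  also have "density M (\<lambda>\<omega>. ennreal (X \<omega>)) = density M (\<lambda>\<omega>. ennreal (k (\<phi> \<omega>)))"
    by (rule density_cong) (use Xk in auto)
  also have "distr \<dots> E \<phi> = density (distr M E \<phi>) (\<lambda>e. ennreal (k e))"
    by (rule density_distr[symmetric]) measurable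
  finally have "AE e in distr M E \<phi>. ennreal (y e) = ennreal (k e)"
    by (subst (asm) N.density_unique_iff) auto
  then have "AE \<omega> in M. ennreal (y (\<phi> \<omega>)) = ennreal (k (\<phi> \<omega>))"
    by (rule AE_distrD[rotated]) measurable
  with Xk show ?thesis
    by eventually_elim (metis X01(1) y01(1) ennreal_inj)
qed

end

lemma generator_subgradient_1:
  assumes "f \<in> divergence_generators"
  obtains s where "subgradient f 1 s"
  using subgradient_exists[OF assms generator_interior[OF assms]] by blast

theorem f_divergence_distr_le:
  assumes PQ: "prob_space P" "prob_space Q" "sets Q = sets P" "\<phi> \<in> measurable P E"
    and f: "f \<in> divergence_generators"
  shows "f_divergence f (distr P E \<phi>) (distr Q E \<phi>) \<le> f_divergence f P Q"
proof -
  obtain s where s: "subgradient f 1 s" by (rule generator_subgradient_1[OF f])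
  show ?thesis
  proof (rule pushforward_representation[OF PQ])
    fix x y
    assume "pushforward_density (sum_measure P Q) E \<phi> x y"
      and D: "\<And>f s. f \<in> divergence_generators \<Longrightarrow> subgradient f 1 s \<Longrightarrow>
        f_divergence f P Q = enn2ereal (\<integral>\<^sup>+\<omega>. perspective f s (x \<omega>) \<partial>sum_measure P Q)"
      "\<And>f s. f \<in> divergence_generators \<Longrightarrow> subgradient f 1 s \<Longrightarrow>
        f_divergence f (distr P E \<phi>) (distr Q E \<phi>)
         = enn2ereal (\<integral>\<^sup>+\<omega>. perspective f s (y (\<phi> \<omega>)) \<partial>sum_measure P Q)"
    then interpret pushforward_density "sum_measure P Q" E \<phi> x y by simp
    show ?thesis
      unfolding D[OF f s] using perspective_integral_le[OF f s] by (simp add: less_eq_ennreal.rep_eq)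
  qed
qed

theorem f_divergence_distr_eq_iff:
  assumes PQ: "prob_space P" "prob_space Q" "sets Q = sets P" "\<phi> \<in> measurable P E"
    and f: "f \<in> divergence_generators" and sc: "strictly_convex_on f {0<..}"
    and fin: "\<bar>f_divergence f P Q\<bar> \<noteq> \<infinity>"
  shows "f_divergence f (distr P E \<phi>) (distr Q E \<phi>) = f_divergence f P Q \<longleftrightarrow>
    (\<exists>h :: 'b \<Rightarrow> ennreal. h \<in> borel_measurable E \<and>
      (AE x in sum_measure P Q. density_ratio P Q x = h (\<phi> x)))"
proof -
  obtain s where s: "subgradient f 1 s" by (rule generator_subgradient_1[OF f])
  show ?thesis
  proof (rule pushforward_representation[OF PQ])
    fix x y
    assume "pushforward_density (sum_measure P Q) E \<phi> x y"
      and ratio: "AE \<omega> in sum_measure P Q. density_ratio P Q \<omega> = ennreal (x \<omega>) / ennreal (1 - x \<omega>)"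
      and D: "\<And>f s. f \<in> divergence_generators \<Longrightarrow> subgradient f 1 s \<Longrightarrow>
        f_divergence f P Q = enn2ereal (\<integral>\<^sup>+\<omega>. perspective f s (x \<omega>) \<partial>sum_measure P Q)"
      "\<And>f s. f \<in> divergence_generators \<Longrightarrow> subgradient f 1 s \<Longrightarrow>
        f_divergence f (distr P E \<phi>) (distr Q E \<phi>)
         = enn2ereal (\<integral>\<^sup>+\<omega>. perspective f s (y (\<phi> \<omega>)) \<partial>sum_measure P Q)"
    then interpret pushforward_density "sum_measure P Q" E \<phi> x y by simp
    let ?I = "\<integral>\<^sup>+\<omega>. perspective f s (x \<omega>) \<partial>sum_measure P Q"
    let ?I' = "\<integral>\<^sup>+\<omega>. perspective f s (y (\<phi> \<omega>)) \<partial>sum_measure P Q"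
    have finI: "?I < \<infinity>"
      using fin unfolding D[OF f s] by (cases ?I) auto
    have "f_divergence f (distr P E \<phi>) (distr Q E \<phi>) = f_divergence f P Q \<longleftrightarrow> ?I' = ?I"
      unfolding D[OF f s] by (simp add: enn2ereal_inject)
    also have "\<dots> \<longleftrightarrow> (AE \<omega> in sum_measure P Q. x \<omega> = y (\<phi> \<omega>))"
    proof
      assume "AE \<omega> in sum_measure P Q. x \<omega> = y (\<phi> \<omega>)"
      then show "?I' = ?I"
        by (intro nn_integral_cong_AE) (auto elim!: eventually_mono)
    qed (rule perspective_integral_eq_imp[OF f s sc finI])
    also have "\<dots> \<longleftrightarrow> (\<exists>h :: 'b \<Rightarrow> ennreal. h \<in> borel_measurable E \<and>
      (AE x in sum_measure P Q. density_ratio P Q x = h (\<phi> x)))"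
    proof
      assume "AE \<omega> in sum_measure P Q. x \<omega> = y (\<phi> \<omega>)"
      with ratio have "AE \<omega> in sum_measure P Q. density_ratio P Q \<omega>
          = ennreal (y (\<phi> \<omega>)) / ennreal (1 - y (\<phi> \<omega>))"
        by eventually_elim simp
      moreover have "(\<lambda>e. ennreal (y e) / ennreal (1 - y e)) \<in> borel_measurable E" by measurable
      ultimately show "\<exists>h :: 'b \<Rightarrow> ennreal. h \<in> borel_measurable E \<and>
          (AE x in sum_measure P Q. density_ratio P Q x = h (\<phi> x))"
        by (intro exI[of _ "\<lambda>e. ennreal (y e) / ennreal (1 - y e)"]) auto
    next
      assume "\<exists>h :: 'b \<Rightarrow> ennreal. h \<in> borel_measurable E \<and>
          (AE x in sum_measure P Q. density_ratio P Q x = h (\<phi> x))"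
      then obtain h :: "'b \<Rightarrow> ennreal" where h: "h \<in> borel_measurable E"
        "AE x in sum_measure P Q. density_ratio P Q x = h (\<phi> x)" by blast
      from h(2) ratio have "AE \<omega> in sum_measure P Q. ennreal (x \<omega>) / ennreal (1 - x \<omega>) = h (\<phi> \<omega>)"
        by eventually_elim simp
      then show "AE \<omega> in sum_measure P Q. x \<omega> = y (\<phi> \<omega>)" by (rule density_factors[OF h(1)])
    qed
    finally show ?thesis .
  qed
qed

lemma AE_scale_measure_iff:
  assumes "r \<noteq> 0"
  shows "(AE x in scale_measure r M. R x) \<longleftrightarrow> (AE x in M. R x)"
  using assms by (simp add: eventually_ae_filter null_sets_def space_scale_measure)

lemma density_RN_deriv_average:
  assumes P: "finite_measure P" and Q: "finite_measure Q" and sets: "sets Q = sets P"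
    and L: "L = scale_measure (1 / 2) (sum_measure P Q)"
  shows "finite_measure L" "density L (RN_deriv L P) = P" "density L (RN_deriv L Q) = Q"
proof -
  interpret S: finite_measure "sum_measure P Q" by (rule finite_measure_sum_measure[OF assms(1-3)])
  show fin: "finite_measure L"
    unfolding L by standard (simp add: space_scale_measure S.emeasure_eq_measure ennreal_mult_eq_top_iff ennreal_divide_eq_top_iff)
  interpret L: finite_measure L by (rule fin)
  have ac: "absolutely_continuous L P" "absolutely_continuous L Q"
    using emeasure_sum_measure[OF sets]
    by (auto simp: absolutely_continuous_def null_sets_def L sets)
  show "density L (RN_deriv L P) = P"
    by (rule L.density_RN_deriv[OF ac(1)]) (simp add: L)
  show "density L (RN_deriv L Q) = Q"
    by (rule L.density_RN_deriv[OF ac(2)]) (simp add: L sets)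
qed

theorem theorem4:
  fixes P Q L :: "'a measure" and E :: "'b measure" and \<phi> :: "'a \<Rightarrow> 'b"
    and f :: "real \<Rightarrow> ereal"
  assumes "prob_space P" and "prob_space Q" and "sets Q = sets P"
    and "\<phi> \<in> measurable P E"
    and "f \<in> divergence_generators"
    and "L = scale_measure (1 / 2) (sum_measure P Q)"
  shows "f_divergence f (distr P E \<phi>) (distr Q E \<phi>) \<le> f_divergence f P Q \<and>
    (AE x in L.
       nn_cond_exp_given L \<phi> E (\<lambda>y. RN_deriv L P y * RN_deriv L Q y) x > 0 \<longrightarrow>
         density_ratio (distr P E \<phi>) (distr Q E \<phi>) (\<phi> x) =
           nn_cond_exp_given Q \<phi> E (density_ratio P Q) x /
           cond_prob_given P \<phi> E {y \<in> space P. density_ratio P Q y < \<infinity>} x \<and>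
         nn_cond_exp_given Q \<phi> E (density_ratio P Q) x /
           cond_prob_given P \<phi> E {y \<in> space P. density_ratio P Q y < \<infinity>} x \<in> {0<..<\<infinity>}) \<and>
    (strictly_convex_on f {0<..} \<and> \<bar>f_divergence f P Q\<bar> \<noteq> \<infinity> \<longrightarrow>
       (f_divergence f (distr P E \<phi>) (distr Q E \<phi>) = f_divergence f P Q \<longleftrightarrow>
         (\<exists>h :: 'b \<Rightarrow> ennreal. h \<in> borel_measurable E \<and>
            (AE x in L. density_ratio P Q x = h (\<phi> x)))))"
proof (intro conjI impI)
  note L = density_RN_deriv_average[OF prob_space.finite_measure[OF assms(1)]
      prob_space.finite_measure[OF assms(2)] assms(3,6)]
  have AE_L: "(AE x in L. R x) \<longleftrightarrow> (AE x in sum_measure P Q. R x)" for R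
    unfolding assms(6) by (rule AE_scale_measure_iff) simp
  have \<phi>L: "\<phi> \<in> measurable L E"
    using assms(4) measurable_cong_sets[of L P E E] by (simp add: assms(6))
  show "f_divergence f (distr P E \<phi>) (distr Q E \<phi>) \<le> f_divergence f P Q"
    by (rule f_divergence_distr_le[OF assms(1-5)])
  show "AE x in L.
       nn_cond_exp_given L \<phi> E (\<lambda>y. RN_deriv L P y * RN_deriv L Q y) x > 0 \<longrightarrow>
         density_ratio (distr P E \<phi>) (distr Q E \<phi>) (\<phi> x) =
           nn_cond_exp_given Q \<phi> E (density_ratio P Q) x /
           cond_prob_given P \<phi> E {y \<in> space P. density_ratio P Q y < \<infinity>} x \<and>
         nn_cond_exp_given Q \<phi> E (density_ratio P Q) x /
           cond_prob_given P \<phi> E {y \<in> space P. density_ratio P Q y < \<infinity>} x \<in> {0<..<\<infinity>}"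
    by (rule density_ratio_distr_eq[OF L(1) assms(1,2) \<phi>L]) (simp_all add: L AE_L)
  assume "strictly_convex_on f {0<..} \<and> \<bar>f_divergence f P Q\<bar> \<noteq> \<infinity>"
  then show "f_divergence f (distr P E \<phi>) (distr Q E \<phi>) = f_divergence f P Q \<longleftrightarrow>
      (\<exists>h :: 'b \<Rightarrow> ennreal. h \<in> borel_measurable E \<and> (AE x in L. density_ratio P Q x = h (\<phi> x)))"
    unfolding AE_L by (elim conjE) (rule f_divergence_distr_eq_iff[OF assms(1-5)])
qed

end
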